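(* Let $d\mu=d\mu_1\times\cdots\times d\mu_n$ be a product measure on $\mathbb{C}^n$, where each $\mu_k$ is a circle-invariant positive Borel measure on $\mathbb{C}$ with $0<\int_{\mathbb{C}}|z|^{2j}\,d\mu_k<\infty$ for all $j\in\mathbb{N}$, and put $c_k^j=\left(\int_{\mathbb{C}}|z|^{2j}\,d\mu_k\right)^{-1}$. Then the canonical solution operator $S\colon A^2_{(0,1)}(d\mu)\to L^2(d\mu)$ to $\bar\partial$ is bounded if and only if there exists a constant $C$ such that $$\frac{c_k^{j+1}}{c_k^{j+2}}-\frac{c_k^{j}}{c_k^{j+1}}<C$$ for all $j\in\mathbb{N}$ and all $k=1,\dots,n$. Equivalently, $S$ is bounded if and only if for every $j=1,\dots,n$ the canonical solution operator $S_j\colon A^2(d\mu_j)\to L^2(d\mu_j)$ to $\bar\partial$ on $\mathbb{C}$ is bounded.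
   Context: $\mathbb{N}=\{0,1,2,\dots\}$. In $c_k^j$, $j$ is an upper index, not a power. A measure on $\mathbb{C}$ is circle-invariant if it is invariant under $z\mapsto e^{i\theta}z$ for all $\theta\in\mathbb{R}$. For a positive Borel measure $\nu$ on $\mathbb{C}^m$ for which the monomials $z^\alpha$, $\alpha\in\mathbb{N}^m$, are nonzero, belong to $L^2(d\nu)$ and are pairwise orthogonal: $A^2(d\nu)$ is the closure in $L^2(d\nu)$ of the linear span of the monomials; $A^2_{(0,1)}(d\nu)$ is the Hilbert space of $(0,1)$-forms $\sum_{i=1}^m f_i\,d\bar z_i$ with $f_i\in A^2(d\nu)$, with norm squared $\sum_i\|f_i\|^2_{L^2(d\nu)}$. For $m=1$, $A^2_{(0,1)}(d\nu)$ is identified with $A^2(d\nu)$ via $f\,d\bar z\leftrightarrow f$. Canonical solution operator: $S\omega$ is the solution $f\in L^2(d\nu)$ of $\bar\partial f=\omega$ that is orthogonal to $A^2(d\nu)$. Concretely, since $\bar\partial(\bar z_i z^\alpha)=z^\alpha d\bar z_i$, on the dense subspace of forms with polynomial coefficients (finite linear combinations of the $z^\alpha d\bar z_i$) it is the linear map for which $S(z^\alpha d\bar z_i)$ is the unique element of $\bar z_i z^\alpha+A^2(d\nu)$ orthogonal to $A^2(d\nu)$. "Bounded" means that this densely defined map extends to a bounded operator $A^2_{(0,1)}(d\nu)\to L^2(d\nu)$. $S$ is this operator for $\nu=\mu$, $m=n$, and $S_j$ is this operator for $\nu=\mu_j$, $m=1$. *)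

theory Defs
  imports "HOL-Analysis.Analysis"
begin

definition circle_invariant :: "complex measure \<Rightarrow> bool" where
  "circle_invariant M \<longleftrightarrow> (\<forall>\<theta>::real. distr M borel (\<lambda>z. cis \<theta> * z) = M)"

definition prod_measure :: "('n::finite \<Rightarrow> complex measure) \<Rightarrow> (complex ^ 'n) measure" where
  "prod_measure \<mu> = distr (Pi\<^sub>M UNIV \<mu>) borel (\<lambda>x. \<chi> k. x k)"

text \<open>Identifies the complex plane with one-dimensional complex space, \<open>vec z\<close> being the vector with
  single entry \<open>z\<close>.\<close>

definition line_measure :: "complex measure \<Rightarrow> (complex ^ 1) measure" where
  "line_measure M = distr M borel vec"

definition moment_recip :: "complex measure \<Rightarrow> nat \<Rightarrow> real" where
  "moment_recip M j = inverse (\<integral>z. cmod z ^ (2 * j) \<partial>M)"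

text \<open>Elements of \<open>L\<^sup>2(d\<nu>)\<close> are represented by functions; equality in \<open>L\<^sup>2(d\<nu>)\<close> is equality
  almost everywhere.\<close>

definition L2 :: "'a measure \<Rightarrow> ('a \<Rightarrow> complex) set" where
  "L2 \<nu> = {f \<in> borel_measurable \<nu>. integrable \<nu> (\<lambda>z. (cmod (f z))\<^sup>2)}"

definition L2_norm :: "'a measure \<Rightarrow> ('a \<Rightarrow> complex) \<Rightarrow> real" where
  "L2_norm \<nu> f = sqrt (\<integral>z. (cmod (f z))\<^sup>2 \<partial>\<nu>)"

definition L2_inner :: "'a measure \<Rightarrow> ('a \<Rightarrow> complex) \<Rightarrow> ('a \<Rightarrow> complex) \<Rightarrow> complex" where
  "L2_inner \<nu> f g = (\<integral>z. f z * cnj (g z) \<partial>\<nu>)"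

definition monomial :: "('m::finite \<Rightarrow> nat) \<Rightarrow> complex ^ 'm \<Rightarrow> complex" where
  "monomial \<alpha> z = (\<Prod>i\<in>UNIV. (z $ i) ^ \<alpha> i)"

definition polynomials :: "(complex ^ 'm::finite \<Rightarrow> complex) set" where
  "polynomials = {(\<lambda>z. \<Sum>\<alpha>\<in>F. a \<alpha> * monomial \<alpha> z) | F a. finite F}"

definition A2 :: "(complex ^ 'm::finite) measure \<Rightarrow> (complex ^ 'm \<Rightarrow> complex) set" where
  "A2 \<nu> = {f \<in> L2 \<nu>. \<forall>\<epsilon>>0. \<exists>p\<in>polynomials. p \<in> L2 \<nu> \<and> L2_norm \<nu> (\<lambda>z. f z - p z) < \<epsilon>}"

text \<open>A \<open>(0,1)\<close>-form is represented by the family of its coefficients: \<open>\<omega> i\<close> is the coefficient of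
  the differential of the conjugate of \<open>z $ i\<close>.\<close>

type_synonym 'm form = "'m \<Rightarrow> complex ^ 'm \<Rightarrow> complex"

definition A2_forms :: "(complex ^ 'm::finite) measure \<Rightarrow> 'm form set" where
  "A2_forms \<nu> = {\<omega>. \<forall>i. \<omega> i \<in> A2 \<nu>}"

definition form_norm :: "(complex ^ 'm::finite) measure \<Rightarrow> 'm form \<Rightarrow> real" where
  "form_norm \<nu> \<omega> = sqrt (\<Sum>i\<in>UNIV. (L2_norm \<nu> (\<omega> i))\<^sup>2)"

definition monomial_form :: "('m::finite \<Rightarrow> nat) \<Rightarrow> 'm \<Rightarrow> 'm form" where
  "monomial_form \<alpha> i = (\<lambda>k z. if k = i then monomial \<alpha> z else 0)"

text \<open>\<open>f\<close> is the value of the canonical solution operator at \<open>monomial_form \<alpha> i\<close>, that is, the element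
  of \<open>(\<lambda>z. cnj (z $ i) * monomial \<alpha> z) + A2 \<nu>\<close> orthogonal to \<open>A2 \<nu>\<close>. It is unique up to equality
  almost everywhere.\<close>

definition is_canonical_solution ::
  "(complex ^ 'm::finite) measure \<Rightarrow> ('m \<Rightarrow> nat) \<Rightarrow> 'm \<Rightarrow> (complex ^ 'm \<Rightarrow> complex) \<Rightarrow> bool" where
  "is_canonical_solution \<nu> \<alpha> i f \<longleftrightarrow>
     f \<in> L2 \<nu> \<and>
     (\<lambda>z. f z - cnj (z $ i) * monomial \<alpha> z) \<in> A2 \<nu> \<and>
     (\<forall>h\<in>A2 \<nu>. L2_inner \<nu> f h = 0)"

text \<open>Linearity holds up to equality almost everywhere; together with the norm bound it makes \<open>T\<close>
  well defined on almost-everywhere classes.\<close>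

definition bounded_operator ::
  "(complex ^ 'm::finite) measure \<Rightarrow> ('m form \<Rightarrow> complex ^ 'm \<Rightarrow> complex) \<Rightarrow> bool" where
  "bounded_operator \<nu> T \<longleftrightarrow>
     (\<forall>\<omega>\<in>A2_forms \<nu>. T \<omega> \<in> L2 \<nu>) \<and>
     (\<forall>\<omega>\<in>A2_forms \<nu>. \<forall>\<eta>\<in>A2_forms \<nu>. \<forall>a b.
        AE z in \<nu>. T (\<lambda>i w. a * \<omega> i w + b * \<eta> i w) z = a * T \<omega> z + b * T \<eta> z) \<and>
     (\<exists>B. \<forall>\<omega>\<in>A2_forms \<nu>. L2_norm \<nu> (T \<omega>) \<le> B * form_norm \<nu> \<omega>)"

text \<open>A linear operator extends the canonical solution operator from the forms with polynomial
  coefficients as soon as it agrees with it on the forms \<open>monomial_form \<alpha> i\<close>,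
  which span them.\<close>

definition canonical_solution_operator_bounded :: "(complex ^ 'm::finite) measure \<Rightarrow> bool" where
  "canonical_solution_operator_bounded \<nu> \<longleftrightarrow>
     (\<exists>T. bounded_operator \<nu> T \<and>
        (\<forall>\<alpha> i. is_canonical_solution \<nu> \<alpha> i (T (monomial_form \<alpha> i))))"

end

theory Submission
  imports Defs
begin

text \<open>
  The forms \<open>monomial_form \<alpha> i\<close> are an orthogonal basis of the space of forms, because integration over
  circles makes different monomials orthogonal. The proof computes the canonical solution operator on this basis
  and finds that it maps it to an orthogonal system again. Such an operator is bounded precisely when the quotients of
  norms are bounded, and these quotients depend on one factor of the measure only.

  In one variable, \<open>cnj z * z ^ a\<close> is orthogonal to every power except \<open>z ^ (a - 1)\<close>, which
  exists when \<open>a \<ge> 1\<close>. Subtracting that power with a suitable coefficient, the quotient of two consecutive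
  moments, gives a function orthogonal to all powers. This is \<open>residual a\<close>, and the square of its norm is the
  difference of two consecutive quotients of moments times the square of the norm of \<open>z ^ a\<close>
  (\<open>inner_residuals\<close>). In several variables the solution for \<open>monomial_form \<alpha> i\<close> is the tensor
  product of the residual in the variable \<open>i\<close> and of powers in the others. Inner products of tensor products
  are products of inner products. Hence two solutions for different indices \<open>i\<close> are orthogonal because a
  residual meets a power, and two solutions for the same \<open>i\<close> and different \<open>\<alpha>\<close> because in some
  variable two different powers or two different residuals meet (\<open>inner_solutions\<close>). The relative squared
  norm is the one-dimensional one, called \<open>gap\<close> (\<open>solution_norm\<close>).

  If the operator has a bounded extension, comparing norms on the basis bounds the gaps: any two canonical solutions
  for the same datum have equal norms (\<open>canonical_solution_norm_unique\<close>). Conversely, if the gaps are bounded,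
  the series obtained by applying the operator to the Fourier expansion of a form converges in norm, by Bessel's
  inequality and the completeness of \<open>L2\<close> (\<open>bessel_inequality\<close>, \<open>orthogonal_series_converges\<close>), and
  its sum is the desired extension. The statement about the one-dimensional operators is the same criterion for
  products with a single factor (\<open>line_measure_eq_prod_measure\<close>), combined with the finiteness of the
  number of factors.
\<close>

section \<open>The space of square integrable functions\<close>

lemma assumes "f \<in> L2 \<nu>"
  shows L2_measurable: "f \<in> borel_measurable \<nu>" and L2_integrable: "integrable \<nu> (\<lambda>z. (cmod (f z))\<^sup>2)"
  using assms by (auto simp: L2_def)

lemma L2_zero [simp]: "(\<lambda>z. 0) \<in> L2 \<nu>"
  by (simp add: L2_def)

lemma L2_dominated:
  assumes "f \<in> borel_measurable \<nu>" "integrable \<nu> g" "\<And>z. (cmod (f z))\<^sup>2 \<le> g z"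
  shows "f \<in> L2 \<nu>"
proof -
  note [measurable] = assms(1)
  have "integrable \<nu> (\<lambda>z. (cmod (f z))\<^sup>2)"
    by (rule Bochner_Integration.integrable_bound[OF assms(2)])
       (use assms(3) in \<open>auto intro!: AE_I2 intro: order_trans[OF _ abs_ge_self]\<close>)
  with assms(1) show ?thesis by (simp add: L2_def)
qed

lemma cmod_add_power2_le: "(cmod (x + y))\<^sup>2 \<le> 2 * (cmod x)\<^sup>2 + 2 * (cmod y)\<^sup>2"
proof -
  have "(cmod (x + y))\<^sup>2 \<le> (cmod x + cmod y)\<^sup>2"
    by (intro power_mono norm_triangle_ineq) auto
  also have "\<dots> \<le> 2 * (cmod x)\<^sup>2 + 2 * (cmod y)\<^sup>2"
    using sum_squares_bound[of "cmod x" "cmod y"] by (simp add: power2_sum)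
  finally show ?thesis .
qed

lemma L2_add: assumes "f \<in> L2 \<nu>" "g \<in> L2 \<nu>" shows "(\<lambda>z. f z + g z) \<in> L2 \<nu>"
  by (rule L2_dominated[where g = "\<lambda>z. 2 * (cmod (f z))\<^sup>2 + 2 * (cmod (g z))\<^sup>2"])
     (use assms in \<open>auto simp: L2_def cmod_add_power2_le\<close>)

lemma L2_cmult: assumes "f \<in> L2 \<nu>" shows "(\<lambda>z. c * f z) \<in> L2 \<nu>"
  using assms by (auto simp: L2_def norm_mult power_mult_distrib)

lemma L2_diff: assumes "f \<in> L2 \<nu>" "g \<in> L2 \<nu>" shows "(\<lambda>z. f z - g z) \<in> L2 \<nu>"
  using L2_add[OF assms(1) L2_cmult[OF assms(2), of "-1"]] by simp

lemma L2_sum: assumes "\<And>b. b \<in> F \<Longrightarrow> f b \<in> L2 \<nu>" shows "(\<lambda>z. \<Sum>b\<in>F. f b z) \<in> L2 \<nu>"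
  using assms by (induction F rule: infinite_finite_induct) (auto intro: L2_add)

lemma L2_norm_power2: "(L2_norm \<nu> f)\<^sup>2 = (\<integral>z. (cmod (f z))\<^sup>2 \<partial>\<nu>)"
  by (simp add: L2_norm_def)

lemma L2_norm_nonneg [simp]: "0 \<le> L2_norm \<nu> f"
  by (simp add: L2_norm_def)

text \<open>The constant \<open>2\<close> in place of the sharp triangle inequality costs nothing below, where only
  convergence to zero and boundedness matter, and it keeps every estimate in terms of squared norms.\<close>

lemma L2_norm_add_le:
  assumes "f \<in> L2 \<nu>" "g \<in> L2 \<nu>"
  shows "(L2_norm \<nu> (\<lambda>z. f z + g z))\<^sup>2 \<le> 2 * (L2_norm \<nu> f)\<^sup>2 + 2 * (L2_norm \<nu> g)\<^sup>2"
proof -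
  have "(\<integral>z. (cmod (f z + g z))\<^sup>2 \<partial>\<nu>) \<le> (\<integral>z. 2 * (cmod (f z))\<^sup>2 + 2 * (cmod (g z))\<^sup>2 \<partial>\<nu>)"
    using L2_integrable[OF L2_add[OF assms]] L2_integrable[OF assms(1)] L2_integrable[OF assms(2)]
    by (intro integral_mono) (auto simp: cmod_add_power2_le)
  also have "\<dots> = 2 * (\<integral>z. (cmod (f z))\<^sup>2 \<partial>\<nu>) + 2 * (\<integral>z. (cmod (g z))\<^sup>2 \<partial>\<nu>)"
    using L2_integrable[OF assms(1)] L2_integrable[OF assms(2)] by simp
  finally show ?thesis by (simp add: L2_norm_power2)
qed

lemma L2_norm_cmult: "(L2_norm \<nu> (\<lambda>z. c * f z))\<^sup>2 = (cmod c)\<^sup>2 * (L2_norm \<nu> f)\<^sup>2"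
  by (simp add: L2_norm_power2 norm_mult power_mult_distrib)

lemma L2_norm_cong_AE:
  assumes "AE z in \<nu>. f z = g z" "f \<in> borel_measurable \<nu>" "g \<in> borel_measurable \<nu>"
  shows "L2_norm \<nu> f = L2_norm \<nu> g"
proof -
  note [measurable] = assms(2,3)
  show ?thesis unfolding L2_norm_def
    by (intro arg_cong[where f = sqrt] integral_cong_AE) (use assms(1) in auto)
qed

lemma L2_norm_eq_0_AE:
  assumes "f \<in> L2 \<nu>" "L2_norm \<nu> f = 0"
  shows "AE z in \<nu>. f z = 0"
proof -
  have "(\<integral>z. (cmod (f z))\<^sup>2 \<partial>\<nu>) = 0" using assms(2) by (simp add: L2_norm_def)
  then show ?thesis
    using integral_nonneg_eq_0_iff_AE[OF L2_integrable[OF assms(1)]] by simp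
qed

lemma borel_measurable_cnj [measurable (raw)]:
  "f \<in> borel_measurable M \<Longrightarrow> (\<lambda>x. cnj (f x)) \<in> borel_measurable M"
  by (rule borel_measurable_continuous_on[OF continuous_on_cnj[OF continuous_on_id]])

lemma L2_inner_integrable:
  assumes "f \<in> L2 \<nu>" "g \<in> L2 \<nu>"
  shows "integrable \<nu> (\<lambda>z. f z * cnj (g z))"
proof (rule Bochner_Integration.integrable_bound)
  show "integrable \<nu> (\<lambda>z. (cmod (f z))\<^sup>2 + (cmod (g z))\<^sup>2)"
    using assms by (auto simp: L2_def)
  note [measurable] = L2_measurable[OF assms(1)] L2_measurable[OF assms(2)]
  show "(\<lambda>z. f z * cnj (g z)) \<in> borel_measurable \<nu>" by measurable
  have "cmod x * cmod y \<le> (cmod x)\<^sup>2 + (cmod y)\<^sup>2" for x y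
  proof -
    have "0 \<le> cmod x * cmod y" by simp
    with sum_squares_bound[of "cmod x" "cmod y"] show ?thesis unfolding mult.assoc by linarith
  qed
  then show "AE z in \<nu>. norm (f z * cnj (g z)) \<le> norm ((cmod (f z))\<^sup>2 + (cmod (g z))\<^sup>2)"
    by (auto simp: norm_mult)
qed

lemma L2_inner_commute: "L2_inner \<nu> g f = cnj (L2_inner \<nu> f g)"
  unfolding L2_inner_def Bochner_Integration.integral_cnj[symmetric] by (simp add: mult.commute)

lemma L2_inner_self: "L2_inner \<nu> f f = of_real ((L2_norm \<nu> f)\<^sup>2)"
  by (simp add: L2_inner_def L2_norm_power2 complex_norm_square[symmetric] flip: integral_complex_of_real)

lemma L2_inner_cong_AE:
  assumes "AE z in \<nu>. f z = g z" "f \<in> borel_measurable \<nu>" "g \<in> borel_measurable \<nu>"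
    "h \<in> borel_measurable \<nu>"
  shows "L2_inner \<nu> f h = L2_inner \<nu> g h"
proof -
  note [measurable] = assms(2-)
  show ?thesis unfolding L2_inner_def
    by (intro integral_cong_AE) (use assms(1) in auto)
qed

lemma L2_inner_add_left:
  assumes "f \<in> L2 \<nu>" "g \<in> L2 \<nu>" "h \<in> L2 \<nu>"
  shows "L2_inner \<nu> (\<lambda>z. f z + g z) h = L2_inner \<nu> f h + L2_inner \<nu> g h"
  using L2_inner_integrable[OF assms(1,3)] L2_inner_integrable[OF assms(2,3)]
  by (simp add: L2_inner_def distrib_right)

lemma L2_inner_diff_left:
  assumes "f \<in> L2 \<nu>" "g \<in> L2 \<nu>" "h \<in> L2 \<nu>"
  shows "L2_inner \<nu> (\<lambda>z. f z - g z) h = L2_inner \<nu> f h - L2_inner \<nu> g h"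
  using L2_inner_integrable[OF assms(1,3)] L2_inner_integrable[OF assms(2,3)]
  by (simp add: L2_inner_def left_diff_distrib)

lemma L2_inner_cmult_left: "L2_inner \<nu> (\<lambda>z. c * f z) h = c * L2_inner \<nu> f h"
  by (simp add: L2_inner_def mult.assoc)

lemma L2_inner_sum_left:
  assumes "\<And>b. b \<in> F \<Longrightarrow> f b \<in> L2 \<nu>" "h \<in> L2 \<nu>"
  shows "L2_inner \<nu> (\<lambda>z. \<Sum>b\<in>F. f b z) h = (\<Sum>b\<in>F. L2_inner \<nu> (f b) h)"
  unfolding L2_inner_def sum_distrib_right
  by (intro Bochner_Integration.integral_sum L2_inner_integrable assms)

lemma L2_inner_diff_right:
  assumes "f \<in> L2 \<nu>" "g \<in> L2 \<nu>" "h \<in> L2 \<nu>"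
  shows "L2_inner \<nu> h (\<lambda>z. f z - g z) = L2_inner \<nu> h f - L2_inner \<nu> h g"
  using L2_inner_diff_left[OF assms] by (simp add: L2_inner_commute[of \<nu> h])

lemma L2_inner_cmult_right: "L2_inner \<nu> h (\<lambda>z. c * f z) = cnj c * L2_inner \<nu> h f"
  using L2_inner_cmult_left[of \<nu> c f h] by (simp add: L2_inner_commute[of \<nu> h])

lemma L2_inner_sum_right:
  assumes "\<And>b. b \<in> F \<Longrightarrow> f b \<in> L2 \<nu>" "h \<in> L2 \<nu>"
  shows "L2_inner \<nu> h (\<lambda>z. \<Sum>b\<in>F. f b z) = (\<Sum>b\<in>F. L2_inner \<nu> h (f b))"
  using L2_inner_sum_left[OF assms, of F] by (simp add: L2_inner_commute[of \<nu> h])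

text \<open>A form of the Cauchy--Schwarz inequality with a free parameter: pointwise it is the arithmetic-geometric
  mean inequality, and a small \<open>t\<close> makes it useful as soon as \<open>g\<close> is much smaller than \<open>t\<close>.\<close>

lemma L2_inner_bound:
  assumes "f \<in> L2 \<nu>" "g \<in> L2 \<nu>" "0 < t"
  shows "cmod (L2_inner \<nu> f g) \<le> t * (L2_norm \<nu> f)\<^sup>2 + (L2_norm \<nu> g)\<^sup>2 / t"
proof -
  have *: "cmod x * cmod y \<le> t * (cmod x)\<^sup>2 + (cmod y)\<^sup>2 / t" for x y
  proof -
    have "0 \<le> (t * cmod x - cmod y)\<^sup>2 + t * cmod x * cmod y"
      using assms(3) by simp
    also have "\<dots> \<le> t * (t * (cmod x)\<^sup>2 + (cmod y)\<^sup>2 / t - cmod x * cmod y)"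
      using assms(3) by (simp add: field_simps power2_eq_square)
    finally show ?thesis using assms(3) by (simp add: zero_le_mult_iff)
  qed
  have "cmod (L2_inner \<nu> f g) \<le> (\<integral>z. t * (cmod (f z))\<^sup>2 + (cmod (g z))\<^sup>2 / t \<partial>\<nu>)"
    unfolding L2_inner_def
  proof (rule order_trans[OF integral_norm_bound integral_mono])
    show "integrable \<nu> (\<lambda>z. cmod (f z * cnj (g z)))"
      by (intro integrable_norm L2_inner_integrable assms)
    show "integrable \<nu> (\<lambda>z. t * (cmod (f z))\<^sup>2 + (cmod (g z))\<^sup>2 / t)"
      using assms by (auto simp: L2_def)
  qed (use * in \<open>simp add: norm_mult\<close>)
  also have "\<dots> = t * (L2_norm \<nu> f)\<^sup>2 + (L2_norm \<nu> g)\<^sup>2 / t"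
    using L2_integrable[OF assms(1)] L2_integrable[OF assms(2)] by (simp add: L2_norm_power2)
  finally show ?thesis .
qed

lemma L2_norm_diff_power2:
  assumes "f \<in> L2 \<nu>" "g \<in> L2 \<nu>"
  shows "(L2_norm \<nu> (\<lambda>z. f z - g z))\<^sup>2
       = (L2_norm \<nu> f)\<^sup>2 - 2 * Re (L2_inner \<nu> f g) + (L2_norm \<nu> g)\<^sup>2"
proof -
  have "complex_of_real ((L2_norm \<nu> (\<lambda>z. f z - g z))\<^sup>2)
      = L2_inner \<nu> f f - L2_inner \<nu> f g - (cnj (L2_inner \<nu> f g) - L2_inner \<nu> g g)"
    unfolding L2_inner_self[symmetric] L2_inner_commute[of \<nu> g f, symmetric]
    by (simp add: L2_inner_diff_left L2_inner_diff_right L2_diff assms)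
  from arg_cong[where f = Re, OF this] show ?thesis by (simp add: L2_inner_self)
qed

section \<open>Orthogonal families\<close>

lemma L2_norm_orthogonal_sum:
  assumes "\<And>b. e b \<in> L2 \<nu>" "\<And>b b'. b \<noteq> b' \<Longrightarrow> L2_inner \<nu> (e b) (e b') = 0" "finite F"
  shows "(L2_norm \<nu> (\<lambda>z. \<Sum>b\<in>F. c b * e b z))\<^sup>2 = (\<Sum>b\<in>F. (cmod (c b))\<^sup>2 * (L2_norm \<nu> (e b))\<^sup>2)"
proof -
  note L = L2_cmult[OF assms(1)]
  have "L2_inner \<nu> (\<lambda>z. \<Sum>b\<in>F. c b * e b z) (\<lambda>z. \<Sum>b\<in>F. c b * e b z)
      = (\<Sum>b\<in>F. \<Sum>b'\<in>F. c b * (cnj (c b') * L2_inner \<nu> (e b) (e b')))"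
    by (simp add: L2_inner_sum_left L2_inner_sum_right L2_sum L L2_inner_cmult_left L2_inner_cmult_right assms(1)
        sum_distrib_left)
  also have "\<dots> = (\<Sum>b\<in>F. \<Sum>b'\<in>F. if b = b' then c b * (cnj (c b) * L2_inner \<nu> (e b) (e b)) else 0)"
    by (intro sum.cong) (auto simp: assms(2))
  also have "\<dots> = complex_of_real (\<Sum>b\<in>F. (cmod (c b))\<^sup>2 * (L2_norm \<nu> (e b))\<^sup>2)"
    using assms(3) by (simp add: L2_inner_self complex_norm_square mult.assoc del: of_real_power)
  finally show ?thesis unfolding L2_inner_self of_real_eq_iff .
qed

definition fourier :: "'a measure \<Rightarrow> ('a \<Rightarrow> complex) \<Rightarrow> ('a \<Rightarrow> complex) \<Rightarrow> complex" where
  "fourier \<nu> e f = L2_inner \<nu> f e / of_real ((L2_norm \<nu> e)\<^sup>2)"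

text \<open>The squared distance from \<open>f\<close> to its Fourier sum is nonnegative and equals the difference of the two
  sides.\<close>

lemma bessel_inequality:
  assumes "\<And>b. e b \<in> L2 \<nu>" "\<And>b b'. b \<noteq> b' \<Longrightarrow> L2_inner \<nu> (e b) (e b') = 0" "finite F" "f \<in> L2 \<nu>"
  shows "(\<Sum>b\<in>F. (cmod (fourier \<nu> (e b) f))\<^sup>2 * (L2_norm \<nu> (e b))\<^sup>2) \<le> (L2_norm \<nu> f)\<^sup>2"
proof -
  define p where "p = (\<lambda>z. \<Sum>b\<in>F. fourier \<nu> (e b) f * e b z)"
  have p: "p \<in> L2 \<nu>" unfolding p_def by (intro L2_sum L2_cmult assms)
  have np: "(L2_norm \<nu> p)\<^sup>2 = (\<Sum>b\<in>F. (cmod (fourier \<nu> (e b) f))\<^sup>2 * (L2_norm \<nu> (e b))\<^sup>2)"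
    unfolding p_def by (intro L2_norm_orthogonal_sum assms)
  have "L2_inner \<nu> f p = (\<Sum>b\<in>F. cnj (fourier \<nu> (e b) f) * L2_inner \<nu> f (e b))"
    unfolding p_def by (simp add: L2_inner_sum_right L2_cmult assms L2_inner_cmult_right)
  also have "\<dots> = (\<Sum>b\<in>F. of_real ((cmod (fourier \<nu> (e b) f))\<^sup>2 * (L2_norm \<nu> (e b))\<^sup>2))"
  proof (intro sum.cong refl)
    fix b
    show "cnj (fourier \<nu> (e b) f) * L2_inner \<nu> f (e b)
        = of_real ((cmod (fourier \<nu> (e b) f))\<^sup>2 * (L2_norm \<nu> (e b))\<^sup>2)"
    proof (cases "L2_norm \<nu> (e b) = 0")
      case False
      define n where "n = complex_of_real ((L2_norm \<nu> (e b))\<^sup>2)"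
      have "L2_inner \<nu> f (e b) = fourier \<nu> (e b) f * n"
        using False by (simp add: fourier_def n_def)
      then show ?thesis
        by (simp only: of_real_mult n_def[symmetric] complex_norm_square mult_ac)
    qed (simp add: fourier_def)
  qed
  finally have "Re (L2_inner \<nu> f p) = (L2_norm \<nu> p)\<^sup>2" by (simp add: np)
  with L2_norm_diff_power2[OF assms(4) p] zero_le_power2[of "L2_norm \<nu> (\<lambda>z. f z - p z)"]
  have "0 \<le> (L2_norm \<nu> f)\<^sup>2 - (L2_norm \<nu> p)\<^sup>2"
    by linarith
  then show ?thesis by (simp add: np)
qed

lemma fourier_linear:
  assumes "f \<in> L2 \<nu>" "g \<in> L2 \<nu>" "e \<in> L2 \<nu>"
  shows "fourier \<nu> e (\<lambda>z. a * f z + b * g z) = a * fourier \<nu> e f + b * fourier \<nu> e g"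
  by (simp add: fourier_def L2_inner_add_left L2_cmult assms L2_inner_cmult_left add_divide_distrib)

section \<open>Completeness and orthogonal series\<close>

text \<open>The weights \<open>2 ^ k\<close> are chosen so that the weighted squared steps still have summable integrals. Hence
  their sum is finite almost everywhere, and this forces the steps themselves to be summable there.\<close>

lemma AE_convergent_of_summable_L2_steps:
  assumes f: "\<And>n. f n \<in> L2 \<nu>"
    and d: "\<And>k. (L2_norm \<nu> (\<lambda>z. f (Suc k) z - f k z))\<^sup>2 \<le> (1/4) ^ k"
  shows "AE z in \<nu>. convergent (\<lambda>k. f k z)"
proof -
  note [measurable] = L2_measurable[OF f]
  define w where "w k z = 2 ^ k * (cmod (f (Suc k) z - f k z))\<^sup>2" for k z
  have [measurable]: "w k \<in> borel_measurable \<nu>" for k unfolding w_def by measurable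
  have w_int: "integrable \<nu> (w k)" for k
    unfolding w_def using L2_integrable[OF L2_diff[OF f f]] by simp
  have "(\<integral>\<^sup>+z. ennreal (w k z) \<partial>\<nu>) \<le> ennreal ((1/2) ^ k)" for k
  proof -
    have "(\<integral>\<^sup>+z. ennreal (w k z) \<partial>\<nu>) = ennreal (\<integral>z. w k z \<partial>\<nu>)"
      by (intro nn_integral_eq_integral w_int) (simp add: w_def)
    also have "(\<integral>z. w k z \<partial>\<nu>) \<le> 2 ^ k * (1/4) ^ k"
      unfolding w_def using d[of k] by (simp add: L2_norm_power2)
    also have "\<dots> = (1/2) ^ k" unfolding power_mult_distrib[symmetric] by simp
    finally show ?thesis by (simp add: ennreal_leI)
  qed
  then have "(\<Sum>k. \<integral>\<^sup>+z. ennreal (w k z) \<partial>\<nu>) \<le> (\<Sum>k. ennreal ((1/2) ^ k))"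
    by (intro suminf_le) auto
  also have "\<dots> = ennreal (\<Sum>k. (1/2) ^ k)"
    by (intro suminf_ennreal2) (auto intro: summable_geometric)
  finally have "(\<integral>\<^sup>+z. (\<Sum>k. ennreal (w k z)) \<partial>\<nu>) \<noteq> \<infinity>"
    by (subst nn_integral_suminf) (auto simp: top_unique)
  then have "AE z in \<nu>. (\<Sum>k. ennreal (w k z)) \<noteq> \<infinity>"
    by (intro nn_integral_PInf_AE) auto
  then show ?thesis
  proof eventually_elim
    case (elim z)
    have sw: "summable (\<lambda>k. w k z)"
      by (rule summable_suminf_not_top) (use elim in \<open>auto simp: w_def\<close>)
    have "summable (\<lambda>k. f (Suc k) z - f k z)"
    proof (rule summable_comparison_test')
      show "summable (\<lambda>k. (1/2) ^ k + w k z)"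
        by (intro summable_add sw) (auto intro: summable_geometric)
      \<comment> \<open>A step larger than \<open>(1/2) ^ k\<close> is dominated by its own weighted square.\<close>
      show "norm (f (Suc k) z - f k z) \<le> (1/2) ^ k + w k z" for k
      proof -
        have "cmod x \<le> (1/2) ^ k + 2 ^ k * (cmod x)\<^sup>2" for x
        proof (cases "cmod x \<le> (1/2) ^ k")
          case True then show ?thesis by (simp add: add_increasing2)
        next
          case False
          then have "1 \<le> 2 ^ k * cmod x" by (simp add: field_simps power_divide)
          then have "1 * cmod x \<le> (2 ^ k * cmod x) * cmod x" by (intro mult_right_mono) auto
          then show ?thesis by (simp add: power2_eq_square mult.assoc add_increasing)
        qed
        then show ?thesis by (simp add: w_def)
      qed
    qed
    then have "convergent (\<lambda>n. \<Sum>k<n. f (Suc k) z - f k z)" by (simp add: summable_iff_convergent)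
    then have "convergent (\<lambda>n. f n z - f 0 z)" by (simp add: sum_lessThan_telescope[of "\<lambda>k. f k z"])
    from convergent_add[OF this convergent_const[of "f 0 z"]] show ?case by simp
  qed
qed

lemma L2_fatou:
  assumes f: "\<And>k. f k \<in> L2 \<nu>" and g: "g \<in> borel_measurable \<nu>"
    and lim: "AE z in \<nu>. (\<lambda>k. f k z) \<longlonglongrightarrow> g z"
    and bnd: "\<forall>\<^sub>F k in sequentially. (L2_norm \<nu> (f k))\<^sup>2 \<le> B"
  shows "g \<in> L2 \<nu>" and "(L2_norm \<nu> g)\<^sup>2 \<le> B"
proof -
  note [measurable] = L2_measurable[OF f] g
  have B: "0 \<le> B"
    using eventually_happens'[OF _ bnd] by (auto intro: order_trans[OF zero_le_power2])
  have "AE z in \<nu>. ennreal ((cmod (g z))\<^sup>2) = liminf (\<lambda>k. ennreal ((cmod (f k z))\<^sup>2))"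
    using lim
  proof eventually_elim
    case (elim z)
    have "(\<lambda>k. ennreal ((cmod (f k z))\<^sup>2)) \<longlonglongrightarrow> ennreal ((cmod (g z))\<^sup>2)"
      by (intro tendsto_ennrealI tendsto_intros elim)
    from lim_imp_Liminf[OF _ this] show ?case by simp
  qed
  then have "(\<integral>\<^sup>+z. ennreal ((cmod (g z))\<^sup>2) \<partial>\<nu>) = (\<integral>\<^sup>+z. liminf (\<lambda>k. ennreal ((cmod (f k z))\<^sup>2)) \<partial>\<nu>)"
    by (rule nn_integral_cong_AE)
  also have "\<dots> \<le> liminf (\<lambda>k. \<integral>\<^sup>+z. ennreal ((cmod (f k z))\<^sup>2) \<partial>\<nu>)"
    by (rule nn_integral_liminf) measurable
  also have "\<dots> = liminf (\<lambda>k. ennreal ((L2_norm \<nu> (f k))\<^sup>2))"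
    unfolding L2_norm_power2 by (subst nn_integral_eq_integral[OF L2_integrable[OF f]]) auto
  also have "\<dots> \<le> liminf (\<lambda>k::nat. ennreal B)"
    by (rule Liminf_mono) (use bnd in \<open>auto elim!: eventually_mono intro: ennreal_leI\<close>)
  also have "\<dots> = ennreal B" by (simp add: Liminf_const)
  finally have le: "(\<integral>\<^sup>+z. ennreal ((cmod (g z))\<^sup>2) \<partial>\<nu>) \<le> ennreal B" .
  have int: "integrable \<nu> (\<lambda>z. (cmod (g z))\<^sup>2)"
    by (rule integrableI_nonneg) (use le in \<open>auto simp: less_top[symmetric] top_unique\<close>)
  then show "g \<in> L2 \<nu>" by (simp add: L2_def)
  from le have "ennreal (\<integral>z. (cmod (g z))\<^sup>2 \<partial>\<nu>) \<le> ennreal B"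
    by (subst (asm) nn_integral_eq_integral[OF int]) auto
  then show "(L2_norm \<nu> g)\<^sup>2 \<le> B" using B by (simp add: L2_norm_power2)
qed

text \<open>The theorem of Riesz and Fischer. A subsequence with geometrically small steps converges almost everywhere;
  Fatou's lemma, applied to its differences with a fixed member, shows that its pointwise limit is also the limit
  in norm of the whole sequence.\<close>

theorem L2_complete:
  assumes f: "\<And>n. f n \<in> L2 \<nu>"
    and cauchy: "\<And>\<epsilon>. 0 < \<epsilon> \<Longrightarrow> \<exists>N. \<forall>m\<ge>N. \<forall>n\<ge>N. (L2_norm \<nu> (\<lambda>z. f m z - f n z))\<^sup>2 \<le> \<epsilon>"
  obtains g where "g \<in> L2 \<nu>" "(\<lambda>n. (L2_norm \<nu> (\<lambda>z. g z - f n z))\<^sup>2) \<longlonglongrightarrow> 0"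
proof -
  have "\<exists>N. \<forall>m\<ge>N. \<forall>n\<ge>N. (L2_norm \<nu> (\<lambda>z. f m z - f n z))\<^sup>2 \<le> (1/4) ^ k" for k
    by (rule cauchy) simp
  then obtain N where N: "\<And>k m n. N k \<le> m \<Longrightarrow> N k \<le> n \<Longrightarrow> (L2_norm \<nu> (\<lambda>z. f m z - f n z))\<^sup>2 \<le> (1/4) ^ k"
    by metis
  \<comment> \<open>The summand \<open>k\<close> makes the indices tend to infinity, the sum makes them monotone and at least \<open>N k\<close>.\<close>
  define r where "r k = k + (\<Sum>i\<le>k. N i)" for k
  have r1: "N k \<le> r k" for k
    using member_le_sum[of k "{..k}" N] by (simp add: r_def)
  have r2: "r k \<le> r (Suc k)" and r3: "k \<le> r k" for k by (simp_all add: r_def)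
  have conv: "AE z in \<nu>. convergent (\<lambda>k. f (r k) z)"
    by (rule AE_convergent_of_summable_L2_steps[OF f]) (metis N r1 r2 order_trans)
  define g where "g z = lim (\<lambda>k. f (r k) z)" for z
  note [measurable] = L2_measurable[OF f]
  have [measurable]: "g \<in> borel_measurable \<nu>" unfolding g_def by measurable
  have lim: "AE z in \<nu>. (\<lambda>k. f (r k) z) \<longlonglongrightarrow> g z"
    using conv by eventually_elim (simp add: g_def convergent_LIMSEQ_iff)
  have key: "(\<lambda>z. g z - f n z) \<in> L2 \<nu> \<and> (L2_norm \<nu> (\<lambda>z. g z - f n z))\<^sup>2 \<le> \<epsilon>"
    if "\<And>m. M \<le> m \<Longrightarrow> (L2_norm \<nu> (\<lambda>z. f m z - f n z))\<^sup>2 \<le> \<epsilon>" for n M \<epsilon>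
  proof -
    have "AE z in \<nu>. (\<lambda>k. f (r k) z - f n z) \<longlonglongrightarrow> g z - f n z"
      using lim by eventually_elim (intro tendsto_intros)
    moreover have "\<forall>\<^sub>F k in sequentially. (L2_norm \<nu> (\<lambda>z. f (r k) z - f n z))\<^sup>2 \<le> \<epsilon>"
      using eventually_ge_at_top[of M] by eventually_elim (rule that, use r3 order_trans in blast)
    ultimately show ?thesis
      using L2_fatou[of "\<lambda>k z. f (r k) z - f n z", OF L2_diff[OF f f]] by simp
  qed
  have "(\<lambda>z. g z - f (N 0) z) \<in> L2 \<nu>"
    using key[of "N 0" "N 0" "1"] N[of 0] by simp
  from L2_add[OF this f[of "N 0"]] have "g \<in> L2 \<nu>" by simp
  moreover have "(\<lambda>n. (L2_norm \<nu> (\<lambda>z. g z - f n z))\<^sup>2) \<longlonglongrightarrow> 0"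
  proof (rule LIMSEQ_I)
    fix e :: real assume "0 < e"
    then obtain M where "\<forall>m\<ge>M. \<forall>n\<ge>M. (L2_norm \<nu> (\<lambda>z. f m z - f n z))\<^sup>2 \<le> e / 2"
      using cauchy[of "e / 2"] by auto
    then have "(L2_norm \<nu> (\<lambda>z. g z - f n z))\<^sup>2 \<le> e / 2" if "n \<ge> M" for n
      using key[of M n "e/2"] that by blast
    then show "\<exists>M. \<forall>n\<ge>M. norm ((L2_norm \<nu> (\<lambda>z. g z - f n z))\<^sup>2 - 0) < e"
      using \<open>0 < e\<close> by (intro exI[of _ M]) (fastforce intro: le_less_trans)
  qed
  ultimately show thesis by (rule that)
qed

lemma L2_limit_unique_AE:
  assumes "\<And>n. f n \<in> L2 \<nu>" "g \<in> L2 \<nu>" "h \<in> L2 \<nu>"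
    and "(\<lambda>n. (L2_norm \<nu> (\<lambda>z. g z - f n z))\<^sup>2) \<longlonglongrightarrow> 0" "(\<lambda>n. (L2_norm \<nu> (\<lambda>z. h z - f n z))\<^sup>2) \<longlonglongrightarrow> 0"
  shows "AE z in \<nu>. g z = h z"
proof -
  have "(L2_norm \<nu> (\<lambda>z. g z - h z))\<^sup>2
      \<le> 2 * (L2_norm \<nu> (\<lambda>z. g z - f n z))\<^sup>2 + 2 * (L2_norm \<nu> (\<lambda>z. h z - f n z))\<^sup>2" for n
    using L2_norm_add_le[OF L2_diff[OF assms(2) assms(1)[of n]] L2_cmult[OF L2_diff[OF assms(3) assms(1)[of n]], of "-1"]]
      L2_norm_cmult[of \<nu> "-1" "\<lambda>z. h z - f n z"] by simp
  moreover have "(\<lambda>n. 2 * (L2_norm \<nu> (\<lambda>z. g z - f n z))\<^sup>2 + 2 * (L2_norm \<nu> (\<lambda>z. h z - f n z))\<^sup>2) \<longlonglongrightarrow> 2 * 0 + 2 * 0"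
    by (intro tendsto_intros assms)
  ultimately have "(L2_norm \<nu> (\<lambda>z. g z - h z))\<^sup>2 \<le> 0"
    by (intro LIMSEQ_le_const) auto
  then have "L2_norm \<nu> (\<lambda>z. g z - h z) = 0" by simp
  from L2_norm_eq_0_AE[OF L2_diff[OF assms(2,3)] this] show ?thesis by simp
qed

lemma L2_norm_limit_le:
  assumes "\<And>n. f n \<in> L2 \<nu>" "g \<in> L2 \<nu>" "(\<lambda>n. (L2_norm \<nu> (\<lambda>z. g z - f n z))\<^sup>2) \<longlonglongrightarrow> 0"
    and "\<And>n. (L2_norm \<nu> (f n))\<^sup>2 \<le> B"
  shows "(L2_norm \<nu> g)\<^sup>2 \<le> 2 * B"
proof -
  have "(L2_norm \<nu> g)\<^sup>2 \<le> 2 * (L2_norm \<nu> (\<lambda>z. g z - f n z))\<^sup>2 + 2 * B" for n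
    using L2_norm_add_le[OF L2_diff[OF assms(2) assms(1)[of n]] assms(1)[of n]] assms(4)[of n] by simp
  moreover have "(\<lambda>n. 2 * (L2_norm \<nu> (\<lambda>z. g z - f n z))\<^sup>2 + 2 * B) \<longlonglongrightarrow> 2 * 0 + 2 * B"
    by (intro tendsto_intros assms)
  ultimately show ?thesis by (intro LIMSEQ_le_const) auto
qed

text \<open>By orthogonality the squared distance of two partial sums is the difference of two members of a bounded
  increasing sequence of reals.\<close>

lemma orthogonal_series_converges:
  fixes F :: "nat \<Rightarrow> 'b set"
  assumes e: "\<And>b. e b \<in> L2 \<nu>" "\<And>b b'. b \<noteq> b' \<Longrightarrow> L2_inner \<nu> (e b) (e b') = 0"
    and F: "\<And>n. finite (F n)" "incseq F"
    and B: "\<And>n. (\<Sum>b\<in>F n. (cmod (c b))\<^sup>2 * (L2_norm \<nu> (e b))\<^sup>2) \<le> B"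
  shows "\<exists>g\<in>L2 \<nu>. (\<lambda>n. (L2_norm \<nu> (\<lambda>z. g z - (\<Sum>b\<in>F n. c b * e b z)))\<^sup>2) \<longlonglongrightarrow> 0"
proof -
  define w where "w b = (cmod (c b))\<^sup>2 * (L2_norm \<nu> (e b))\<^sup>2" for b
  define s where "s n = (\<Sum>b\<in>F n. w b)" for n
  define S where "S n z = (\<Sum>b\<in>F n. c b * e b z)" for n z
  have w0: "0 \<le> w b" for b by (simp add: w_def)
  have inc: "incseq s"
    unfolding s_def using F w0 by (intro monoI sum_mono2) (auto simp: incseq_def)
  have "Cauchy s"
  proof -
    have "s n \<le> B" for n using B by (simp add: s_def w_def)
    then obtain l where "s \<longlonglongrightarrow> l" using incseq_convergent[OF inc, of B] by blast
    then show ?thesis by (rule LIMSEQ_imp_Cauchy)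
  qed
  have SL: "S n \<in> L2 \<nu>" for n unfolding S_def[abs_def] by (intro L2_sum L2_cmult e)
  have step: "(L2_norm \<nu> (\<lambda>z. S m z - S n z))\<^sup>2 = s m - s n" if "n \<le> m" for m n
  proof -
    have sub: "F n \<subseteq> F m" using F(2) that by (auto simp: incseq_def)
    have "(\<lambda>z. S m z - S n z) = (\<lambda>z. \<Sum>b\<in>F m - F n. c b * e b z)"
      unfolding S_def using F(1) sub by (simp add: sum_diff)
    then have "(L2_norm \<nu> (\<lambda>z. S m z - S n z))\<^sup>2 = (\<Sum>b\<in>F m - F n. w b)"
      using L2_norm_orthogonal_sum[OF e, where F = "F m - F n" and c = c] F(1) by (simp add: w_def)
    also have "\<dots> = s m - s n" unfolding s_def using F(1) sub by (simp add: sum_diff)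
    finally show ?thesis .
  qed
  have dist: "(L2_norm \<nu> (\<lambda>z. S m z - S n z))\<^sup>2 = \<bar>s m - s n\<bar>" for m n
  proof (cases "n \<le> m")
    case True
    then show ?thesis using step[OF True] incseqD[OF inc True] by simp
  next
    case False
    then have "m \<le> n" by simp
    have "(L2_norm \<nu> (\<lambda>z. S m z - S n z))\<^sup>2 = (L2_norm \<nu> (\<lambda>z. S n z - S m z))\<^sup>2"
      using L2_norm_cmult[of \<nu> "-1" "\<lambda>z. S n z - S m z"] by simp
    then show ?thesis using step[OF \<open>m \<le> n\<close>] incseqD[OF inc \<open>m \<le> n\<close>] by simp
  qed
  have "\<exists>N. \<forall>m\<ge>N. \<forall>n\<ge>N. (L2_norm \<nu> (\<lambda>z. S m z - S n z))\<^sup>2 \<le> \<epsilon>" if "0 < \<epsilon>" for \<epsilon>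
    using CauchyD[OF \<open>Cauchy s\<close> that] unfolding dist by (auto intro: less_imp_le)
  from L2_complete[OF SL this] show ?thesis unfolding S_def by metis
qed

lemma L2_limit_linear:
  assumes L: "\<And>n. F n \<in> L2 \<nu>" "\<And>n. G n \<in> L2 \<nu>" "f \<in> L2 \<nu>" "g \<in> L2 \<nu>"
    and lim: "(\<lambda>n. (L2_norm \<nu> (\<lambda>z. f z - F n z))\<^sup>2) \<longlonglongrightarrow> 0"
      "(\<lambda>n. (L2_norm \<nu> (\<lambda>z. g z - G n z))\<^sup>2) \<longlonglongrightarrow> 0"
  shows "(\<lambda>n. (L2_norm \<nu> (\<lambda>z. (a * f z + b * g z) - (a * F n z + b * G n z)))\<^sup>2) \<longlonglongrightarrow> 0"
proof (rule tendsto_sandwich[OF _ _ tendsto_const])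
  have "(\<lambda>n. 2 * ((cmod a)\<^sup>2 * (L2_norm \<nu> (\<lambda>z. f z - F n z))\<^sup>2)
      + 2 * ((cmod b)\<^sup>2 * (L2_norm \<nu> (\<lambda>z. g z - G n z))\<^sup>2)) \<longlonglongrightarrow> 2 * ((cmod a)\<^sup>2 * 0) + 2 * ((cmod b)\<^sup>2 * 0)"
    by (intro tendsto_intros lim)
  then show "(\<lambda>n. 2 * ((cmod a)\<^sup>2 * (L2_norm \<nu> (\<lambda>z. f z - F n z))\<^sup>2)
      + 2 * ((cmod b)\<^sup>2 * (L2_norm \<nu> (\<lambda>z. g z - G n z))\<^sup>2)) \<longlonglongrightarrow> 0" by simp
  have "(L2_norm \<nu> (\<lambda>z. (a * f z + b * g z) - (a * F n z + b * G n z)))\<^sup>2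
      \<le> 2 * ((cmod a)\<^sup>2 * (L2_norm \<nu> (\<lambda>z. f z - F n z))\<^sup>2)
        + 2 * ((cmod b)\<^sup>2 * (L2_norm \<nu> (\<lambda>z. g z - G n z))\<^sup>2)" for n
    using L2_norm_add_le[OF L2_cmult[OF L2_diff[OF L(3) L(1)[of n]], of a]
        L2_cmult[OF L2_diff[OF L(4) L(2)[of n]], of b]]
    unfolding L2_norm_cmult by (simp add: algebra_simps)
  then show "\<forall>\<^sub>F n in sequentially. (L2_norm \<nu> (\<lambda>z. (a * f z + b * g z) - (a * F n z + b * G n z)))\<^sup>2
      \<le> 2 * ((cmod a)\<^sup>2 * (L2_norm \<nu> (\<lambda>z. f z - F n z))\<^sup>2)
        + 2 * ((cmod b)\<^sup>2 * (L2_norm \<nu> (\<lambda>z. g z - G n z))\<^sup>2)" by simp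
qed simp

section \<open>Powers on a rotation invariant measure of the plane\<close>

locale rotation_measure =
  fixes M :: "complex measure"
  assumes sets_M [measurable_cong]: "sets M = sets borel"
    and rotation_invariant: "circle_invariant M"
    and moment_integrable: "integrable M (\<lambda>z. cmod z ^ (2 * j))"
    and moment_pos: "0 < (\<integral>z. cmod z ^ (2 * j) \<partial>M)"
begin

definition moment :: "nat \<Rightarrow> real" where
  "moment j = (\<integral>z. cmod z ^ (2 * j) \<partial>M)"

text \<open>The projection of \<open>cnj z * z ^ a\<close> onto the closed span of the powers is \<open>ratio a\<close> times
  \<open>z ^ (a - 1)\<close>, and zero for \<open>a = 0\<close>. The value \<open>ratio 0 = 0\<close> lets one formula cover both cases,
  the truncated exponent \<open>a - 1\<close> being harmless then.\<close>

definition ratio :: "nat \<Rightarrow> real" where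
  "ratio a = (if a = 0 then 0 else moment a / moment (a - 1))"

text \<open>The one-dimensional canonical solution with datum \<open>z ^ a\<close>.\<close>

definition residual :: "nat \<Rightarrow> complex \<Rightarrow> complex" where
  "residual a z = cnj z * z ^ a - of_real (ratio a) * z ^ (a - 1)"

lemma moment_gt_0: "0 < moment j"
  using moment_pos by (simp add: moment_def)

lemma sigma_finite: "sigma_finite_measure M"
proof -
  have "integrable M (\<lambda>z. 1 :: real)" using moment_integrable[of 0] by simp
  then have "finite_measure M" by (simp add: integrable_iff_bounded finite_measureI)
  then interpret finite_measure M .
  show ?thesis by unfold_locales
qed

lemma ratio_diff_eq_moment_recip:
  "ratio (Suc (Suc j)) - ratio (Suc j)
     = moment_recip M (j + 1) / moment_recip M (j + 2) - moment_recip M j / moment_recip M (j + 1)"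
  by (simp add: ratio_def moment_recip_def moment_def divide_simps)

lemma mixed_power_L2: "(\<lambda>z. cnj z ^ b * z ^ a) \<in> L2 M"
proof -
  have "(\<lambda>z. cnj z ^ b * z ^ a) \<in> borel_measurable M" by measurable
  moreover have "(\<lambda>z. (cmod (cnj z ^ b * z ^ a))\<^sup>2) = (\<lambda>z. cmod z ^ (2 * (b + a)))"
    by (auto simp: norm_mult norm_power power_add power_mult_distrib mult_ac simp flip: power_mult)
  ultimately show ?thesis using moment_integrable[of "b + a"] by (simp add: L2_def)
qed

lemma power_L2: "(\<lambda>z. z ^ a) \<in> L2 M" and cnj_power_L2: "(\<lambda>z. cnj z * z ^ a) \<in> L2 M"
  using mixed_power_L2[of 0 a] mixed_power_L2[of 1 a] by simp_all

lemma residual_L2: "residual a \<in> L2 M"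
  unfolding residual_def[abs_def] by (intro L2_diff L2_cmult power_L2 cnj_power_L2)

text \<open>If \<open>a \<noteq> b\<close>, rotation by the angle \<open>pi / (a - b)\<close> changes the sign of \<open>z ^ a * cnj (z ^ b)\<close>, so the integral
  equals its own negative.\<close>

lemma inner_powers: "L2_inner M (\<lambda>z. z ^ a) (\<lambda>z. z ^ b) = (if a = b then of_real (moment a) else 0)"
proof (cases "a = b")
  case True
  have "(\<lambda>z. z ^ b * cnj (z ^ b)) = (\<lambda>z. of_real (cmod z ^ (2 * b)))"
    by (simp only: complex_norm_square[symmetric] norm_power power_mult[symmetric] mult.commute[of 2])
  then show ?thesis using True
    by (simp add: L2_inner_def moment_def del: of_real_power complex_cnj_power)
next
  case False
  define \<theta> where "\<theta> = pi / (real a - real b)"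
  have \<theta>: "real a * \<theta> = pi + real b * \<theta>" using False by (simp add: \<theta>_def field_simps)
  have *: "(cis \<theta> * z) ^ a * cnj ((cis \<theta> * z) ^ b) = - (z ^ a * cnj (z ^ b))" for z
  proof -
    have "cis \<theta> ^ a * cnj (cis \<theta> ^ b) = cis (real a * \<theta> - real b * \<theta>)"
      by (simp only: Complex.DeMoivre complex_cnj_power[symmetric] cis_cnj cis_mult diff_conv_add_uminus)
    also have "\<dots> = -1" using \<theta> by simp
    finally have "cis \<theta> ^ a * cnj (cis \<theta> ^ b) = -1" .
    moreover have "(cis \<theta> * z) ^ a * cnj ((cis \<theta> * z) ^ b)
        = (cis \<theta> ^ a * cnj (cis \<theta> ^ b)) * (z ^ a * cnj (z ^ b))"
      by (simp add: power_mult_distrib)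
    ultimately show ?thesis by simp
  qed
  have "L2_inner M (\<lambda>z. z ^ a) (\<lambda>z. z ^ b)
      = (\<integral>z. z ^ a * cnj (z ^ b) \<partial>(distr M borel (\<lambda>z. cis \<theta> * z)))"
    using rotation_invariant by (simp add: circle_invariant_def L2_inner_def)
  also have "\<dots> = (\<integral>z. (cis \<theta> * z) ^ a * cnj ((cis \<theta> * z) ^ b) \<partial>M)"
    by (rule integral_distr) measurable
  also have "\<dots> = - L2_inner M (\<lambda>z. z ^ a) (\<lambda>z. z ^ b)"
    unfolding * by (simp add: L2_inner_def)
  finally show ?thesis using False by simp
qed

lemma inner_cnj_power:
  "L2_inner M (\<lambda>z. cnj z * z ^ a) (\<lambda>z. z ^ b) = (if a = Suc b then of_real (moment a) else 0)"
  using inner_powers[of a "Suc b"] by (simp add: L2_inner_def mult_ac)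

text \<open>Only \<open>a = b + 1\<close> is not immediate from the orthogonality of powers, and there the value of
  \<open>ratio a\<close> produces the cancellation.\<close>

lemma inner_residual_power: "L2_inner M (residual a) (\<lambda>z. z ^ b) = 0"
proof -
  have "L2_inner M (residual a) (\<lambda>z. z ^ b)
      = (if a = Suc b then of_real (moment a) else 0)
        - of_real (ratio a) * (if a - 1 = b then of_real (moment b) else 0)"
    unfolding residual_def[abs_def]
    by (simp add: L2_inner_diff_left power_L2 cnj_power_L2 L2_cmult L2_inner_cmult_left inner_powers inner_cnj_power)
  also have "\<dots> = 0"
    using moment_gt_0[of b] by (cases a) (auto simp: ratio_def)
  finally show ?thesis .
qed

text \<open>The norm of a residual is where the quantity of the theorem comes from: relative to the norm of
  \<open>z ^ a\<close>, its square is the difference of two consecutive quotients of moments.\<close>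

lemma inner_residuals:
  "L2_inner M (residual a) (residual b)
     = (if a = b then of_real ((ratio (Suc a) - ratio a) * moment a) else 0)"
proof -
  have "L2_inner M (residual a) (residual b) = L2_inner M (residual a) (\<lambda>z. cnj z * z ^ b)"
    unfolding residual_def[of b, abs_def]
    by (simp add: L2_inner_diff_right residual_L2 cnj_power_L2 power_L2 L2_cmult
        L2_inner_cmult_right inner_residual_power)
  also have "\<dots> = L2_inner M (\<lambda>z. cnj z * z ^ a) (\<lambda>z. cnj z * z ^ b)
      - of_real (ratio a) * L2_inner M (\<lambda>z. z ^ (a - 1)) (\<lambda>z. cnj z * z ^ b)"
    unfolding residual_def[of a, abs_def]
    by (simp add: L2_inner_diff_left cnj_power_L2 power_L2 L2_cmult L2_inner_cmult_left)
  also have "L2_inner M (\<lambda>z. cnj z * z ^ a) (\<lambda>z. cnj z * z ^ b)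
      = L2_inner M (\<lambda>z. z ^ Suc a) (\<lambda>z. z ^ Suc b)"
    by (simp add: L2_inner_def mult_ac)
  also have "L2_inner M (\<lambda>z. z ^ (a - 1)) (\<lambda>z. cnj z * z ^ b)
      = (if b = Suc (a - 1) then of_real (moment b) else 0)"
    unfolding L2_inner_commute[of M "\<lambda>z. z ^ (a - 1)"] inner_cnj_power by simp
  also have "L2_inner M (\<lambda>z. z ^ Suc a) (\<lambda>z. z ^ Suc b)
      - of_real (ratio a) * (if b = Suc (a - 1) then of_real (moment b) else 0)
      = (if a = b then of_real ((ratio (Suc a) - ratio a) * moment a) else 0)"
    using moment_gt_0[of a] unfolding inner_powers
    by (cases a) (auto simp: ratio_def left_diff_distrib)
  finally show ?thesis .
qed

end

section \<open>Product measures and tensor products of functions\<close>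

definition tensor :: "('n::finite \<Rightarrow> complex \<Rightarrow> complex) \<Rightarrow> complex ^ 'n \<Rightarrow> complex" where
  "tensor \<phi> z = (\<Prod>k\<in>UNIV. \<phi> k (z $ k))"

lemma monomial_eq_tensor: "monomial \<alpha> = tensor (\<lambda>k w. w ^ \<alpha> k)"
  by (simp add: fun_eq_iff monomial_def tensor_def)

lemma tensor_remove:
  "tensor \<phi> z = \<phi> i (z $ i) * (\<Prod>k\<in>UNIV - {i}. \<phi> k (z $ k))"
  unfolding tensor_def by (rule prod.remove) auto

lemma tensor_measurable:
  fixes \<phi> :: "'n::finite \<Rightarrow> complex \<Rightarrow> complex"
  assumes "\<And>k. \<phi> k \<in> borel_measurable borel"
  shows "tensor \<phi> \<in> borel_measurable borel"
proof -
  note [measurable] = assms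
  have [measurable]: "(\<lambda>z::complex^'n. z $ k) \<in> borel_measurable borel" for k
    by (intro borel_measurable_continuous_onI continuous_intros)
  show ?thesis unfolding tensor_def[abs_def]
    by (intro borel_measurable_prod measurable_compose[OF _ assms]) measurable
qed

lemma measurable_vec_lambda:
  fixes \<mu> :: "'n::finite \<Rightarrow> complex measure"
  assumes "\<And>k. sets (\<mu> k) = sets borel"
  shows "(\<lambda>x. \<chi> k. x k) \<in> borel_measurable (Pi\<^sub>M UNIV \<mu>)"
proof -
  have "(\<lambda>x. x k) \<in> borel_measurable (Pi\<^sub>M UNIV \<mu>)" for k
    using measurable_component_singleton[of k UNIV \<mu>] by (simp add: measurable_cong_sets[OF refl assms])
  then show ?thesis
    by (auto simp: borel_measurable_euclidean_space[of "\<lambda>x. \<chi> k. x k"] Basis_vec_def inner_axis)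
qed

locale rotation_product =
  fixes \<mu> :: "'n::finite \<Rightarrow> complex measure"
  assumes rotation_measure: "\<And>k. rotation_measure (\<mu> k)"
begin

sublocale factor: rotation_measure "\<mu> k" for k by (rule rotation_measure)

sublocale product_sigma_finite \<mu>
  by (simp add: product_sigma_finite_def factor.sigma_finite)

abbreviation "\<nu> \<equiv> prod_measure \<mu>"

lemma measurable_vec [measurable]: "(\<lambda>x. \<chi> k. x k) \<in> measurable (Pi\<^sub>M UNIV \<mu>) borel"
  by (rule measurable_vec_lambda[OF factor.sets_M])

lemma integral_tensor:
  assumes "\<And>k. integrable (\<mu> k) (\<phi> k)"
  shows "integrable \<nu> (tensor \<phi>)" and "(\<integral>z. tensor \<phi> z \<partial>\<nu>) = (\<Prod>k\<in>UNIV. \<integral>w. \<phi> k w \<partial>\<mu> k)"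
proof -
  have "\<phi> k \<in> borel_measurable borel" for k
    using borel_measurable_integrable[OF assms[of k]] by (simp add: measurable_cong_sets[OF factor.sets_M refl])
  note [measurable] = tensor_measurable[OF this]
  have "integrable (Pi\<^sub>M UNIV \<mu>) (\<lambda>x. tensor \<phi> (\<chi> k. x k))"
    unfolding tensor_def using product_integrable_prod[of UNIV \<phi>] assms by simp
  then show "integrable \<nu> (tensor \<phi>)"
    unfolding prod_measure_def by (subst integrable_distr_eq) auto
  have "(\<integral>z. tensor \<phi> z \<partial>\<nu>) = (\<integral>x. tensor \<phi> (\<chi> k. x k) \<partial>Pi\<^sub>M UNIV \<mu>)"
    unfolding prod_measure_def by (rule integral_distr) auto
  also have "\<dots> = (\<Prod>k\<in>UNIV. \<integral>w. \<phi> k w \<partial>\<mu> k)"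
    unfolding tensor_def using product_integral_prod[of UNIV \<phi>] assms by simp
  finally show "(\<integral>z. tensor \<phi> z \<partial>\<nu>) = (\<Prod>k\<in>UNIV. \<integral>w. \<phi> k w \<partial>\<mu> k)" .
qed

lemma inner_tensor:
  assumes "\<And>k. \<phi> k \<in> L2 (\<mu> k)" "\<And>k. \<psi> k \<in> L2 (\<mu> k)"
  shows "L2_inner \<nu> (tensor \<phi>) (tensor \<psi>) = (\<Prod>k\<in>UNIV. L2_inner (\<mu> k) (\<phi> k) (\<psi> k))"
proof -
  have "(\<lambda>z. tensor \<phi> z * cnj (tensor \<psi> z)) = tensor (\<lambda>k w. \<phi> k w * cnj (\<psi> k w))"
    by (simp add: fun_eq_iff tensor_def prod.distrib)
  then show ?thesis
    unfolding L2_inner_def using integral_tensor(2)[OF L2_inner_integrable[OF assms]] by simp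
qed

lemma tensor_L2:
  assumes "\<And>k. \<phi> k \<in> L2 (\<mu> k)"
  shows "tensor \<phi> \<in> L2 \<nu>"
proof -
  have "\<phi> k \<in> borel_measurable borel" for k
    using L2_measurable[OF assms[of k]] by (simp add: measurable_cong_sets[OF factor.sets_M refl])
  then have "tensor \<phi> \<in> borel_measurable \<nu>"
    using tensor_measurable[of \<phi>] by (simp add: prod_measure_def)
  moreover have "integrable \<nu> (\<lambda>z. tensor \<phi> z * cnj (tensor \<phi> z))"
    using integral_tensor(1)[OF L2_inner_integrable[OF assms assms]]
    by (simp add: tensor_def[abs_def] prod.distrib)
  then have "integrable \<nu> (\<lambda>z. (cmod (tensor \<phi> z))\<^sup>2)"
    by (simp add: complex_norm_square[symmetric] complex_of_real_integrable_eq del: of_real_power)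
  ultimately show ?thesis by (simp add: L2_def)
qed

section \<open>Canonical solutions on a product measure\<close>

text \<open>The one-dimensional solution in the variable \<open>z $ i\<close>, tensored with powers in the other variables.
  That it is again a tensor product is what reduces all inner products to dimension one.\<close>

definition solution :: "('n \<Rightarrow> nat) \<Rightarrow> 'n \<Rightarrow> complex ^ 'n \<Rightarrow> complex" where
  "solution \<alpha> i = tensor (\<lambda>k. if k = i then factor.residual i (\<alpha> i) else (\<lambda>w. w ^ \<alpha> k))"

lemma monomial_L2: "monomial \<alpha> \<in> L2 \<nu>"
  unfolding monomial_eq_tensor by (intro tensor_L2 factor.power_L2)

lemma solution_L2: "solution \<alpha> i \<in> L2 \<nu>"
  unfolding solution_def by (intro tensor_L2) (auto simp: factor.power_L2 factor.residual_L2)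

lemma inner_monomials:
  "L2_inner \<nu> (monomial \<alpha>) (monomial \<beta>)
     = (if \<alpha> = \<beta> then of_real (\<Prod>k\<in>UNIV. factor.moment k (\<alpha> k)) else 0)"
  unfolding monomial_eq_tensor
  by (subst inner_tensor) (auto simp: factor.power_L2 factor.inner_powers fun_eq_iff)

lemma monomial_norm: "(L2_norm \<nu> (monomial \<alpha>))\<^sup>2 = (\<Prod>k\<in>UNIV. factor.moment k (\<alpha> k))"
  using L2_inner_self[of \<nu> "monomial \<alpha>"] unfolding inner_monomials
  by (simp del: of_real_power of_real_prod)

lemma monomial_norm_pos: "0 < (L2_norm \<nu> (monomial \<alpha>))\<^sup>2"
  unfolding monomial_norm by (intro prod_pos) (simp add: factor.moment_gt_0)

lemma inner_solution_monomial: "L2_inner \<nu> (solution \<alpha> i) (monomial \<beta>) = 0"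
  unfolding monomial_eq_tensor solution_def
  by (subst inner_tensor) (auto simp: factor.power_L2 factor.residual_L2 factor.inner_residual_power
      intro!: exI[of _ i])

text \<open>For \<open>i \<noteq> j\<close> the factor belonging to \<open>i\<close> pairs a residual with a power, so it vanishes: the
  contributions of different coefficients of a form do not interact. This is why the problem in several variables
  decouples.\<close>

lemma inner_solutions:
  assumes "(\<alpha>, i) \<noteq> (\<beta>, j)"
  shows "L2_inner \<nu> (solution \<alpha> i) (solution \<beta> j) = 0"
proof -
  let ?f = "\<lambda>k. if k = i then factor.residual i (\<alpha> i) else (\<lambda>w. w ^ \<alpha> k)"
  let ?g = "\<lambda>k. if k = j then factor.residual j (\<beta> j) else (\<lambda>w. w ^ \<beta> k)"
  have "L2_inner \<nu> (solution \<alpha> i) (solution \<beta> j) = (\<Prod>k\<in>UNIV. L2_inner (\<mu> k) (?f k) (?g k))"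
    unfolding solution_def by (subst inner_tensor) (auto simp: factor.power_L2 factor.residual_L2)
  moreover have "\<exists>k. L2_inner (\<mu> k) (?f k) (?g k) = 0"
  proof (cases "i = j")
    case False
    then show ?thesis by (intro exI[of _ i]) (simp add: factor.inner_residual_power)
  next
    case True
    with assms obtain k where "\<alpha> k \<noteq> \<beta> k" by auto
    with True show ?thesis
      by (intro exI[of _ k]) (auto simp: factor.inner_residuals factor.inner_powers)
  qed
  ultimately show ?thesis by auto
qed

text \<open>The squared norm of \<open>solution \<alpha> i\<close> relative to that of its datum, with \<open>a = \<alpha> i\<close>.\<close>

definition gap :: "'n \<Rightarrow> nat \<Rightarrow> real" where
  "gap i a = factor.ratio i (Suc a) - factor.ratio i a"

lemma solution_norm: "(L2_norm \<nu> (solution \<alpha> i))\<^sup>2 = gap i (\<alpha> i) * (L2_norm \<nu> (monomial \<alpha>))\<^sup>2"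
proof -
  let ?f = "\<lambda>k. if k = i then factor.residual i (\<alpha> i) else (\<lambda>w. w ^ \<alpha> k)"
  have "complex_of_real ((L2_norm \<nu> (solution \<alpha> i))\<^sup>2) = (\<Prod>k\<in>UNIV. L2_inner (\<mu> k) (?f k) (?f k))"
    unfolding L2_inner_self[symmetric] solution_def
    by (subst inner_tensor) (auto simp: factor.power_L2 factor.residual_L2)
  also have "\<dots> = (\<Prod>k\<in>UNIV. of_real ((if k = i then gap i (\<alpha> i) else 1) * factor.moment k (\<alpha> k)))"
    by (intro prod.cong) (auto simp: factor.inner_residuals factor.inner_powers gap_def)
  also have "\<dots> = of_real (gap i (\<alpha> i) * (L2_norm \<nu> (monomial \<alpha>))\<^sup>2)"
    by (simp add: monomial_norm prod.distrib prod.delta flip: of_real_prod)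
  finally show ?thesis by (simp only: of_real_eq_iff)
qed

lemma solution_eq:
  "solution \<alpha> i z = cnj (z $ i) * monomial \<alpha> z
     - of_real (factor.ratio i (\<alpha> i)) * monomial (\<alpha>(i := \<alpha> i - 1)) z"
  unfolding solution_def monomial_eq_tensor tensor_remove[of _ z i]
  by (simp add: factor.residual_def algebra_simps)

end

text \<open>The one-dimensional operators are the case of a product with a single factor, so that the criterion
  needs to be proved for products only.\<close>

lemma line_measure_eq_prod_measure:
  assumes "rotation_measure M"
  shows "line_measure M = prod_measure (\<lambda>_::1. M)"
proof -
  interpret rotation_product "\<lambda>_::1. M" by (simp add: rotation_product_def assms)
  have U: "UNIV = {1::1}" by (auto simp: num1_eq_iff)
  have v: "vec (x 1) = (\<chi> k::1. x k)" for x :: "1 \<Rightarrow> complex"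
    by (simp add: vec_eq_iff num1_eq_iff)
  have "line_measure M = distr (distr (Pi\<^sub>M {1::1} (\<lambda>_. M)) M (\<lambda>x. x 1)) borel vec"
    unfolding line_measure_def distr_singleton ..
  also have "\<dots> = distr (Pi\<^sub>M {1::1} (\<lambda>_. M)) borel (vec \<circ> (\<lambda>x. x 1))"
  proof (rule distr_distr)
    have "vec \<in> borel_measurable (borel :: complex measure)"
      by (intro borel_measurable_continuous_onI linear_continuous_on) (simp add: linear_conv_bounded_linear[symmetric] linear_vec)
    then show "vec \<in> M \<rightarrow>\<^sub>M (borel :: (complex^1) measure)" by (simp add: measurable_cong_sets[OF factor.sets_M refl])
  qed measurable
  also have "\<dots> = prod_measure (\<lambda>_::1. M)"
    unfolding prod_measure_def U by (simp add: o_def v)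
  finally show ?thesis .
qed

section \<open>Uniqueness of canonical solutions\<close>

lemma A2_L2: "f \<in> A2 \<nu> \<Longrightarrow> f \<in> L2 \<nu>"
  by (simp add: A2_def)

lemma polynomial_A2:
  assumes "p \<in> polynomials" "p \<in> L2 \<nu>" shows "p \<in> A2 \<nu>"
  using assms by (auto simp: A2_def L2_norm_def intro!: bexI[of _ p])

lemma cmult_monomial_A2:
  assumes "monomial \<alpha> \<in> L2 \<nu>" shows "(\<lambda>z. c * monomial \<alpha> z) \<in> A2 \<nu>"
proof (rule polynomial_A2)
  show "(\<lambda>z. c * monomial \<alpha> z) \<in> polynomials"
    unfolding polynomials_def by (auto intro!: exI[of _ "{\<alpha>}"] exI[of _ "\<lambda>_. c"])
qed (rule L2_cmult[OF assms])

lemma A2_cong_AE: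
  assumes "AE z in \<nu>. f z = g z" "f \<in> A2 \<nu>" "g \<in> L2 \<nu>" shows "g \<in> A2 \<nu>"
proof -
  have "L2_norm \<nu> (\<lambda>z. g z - p z) = L2_norm \<nu> (\<lambda>z. f z - p z)" if "p \<in> L2 \<nu>" for p
    using assms(1)
    by (intro L2_norm_cong_AE L2_measurable L2_diff that assms A2_L2) auto
  then show ?thesis using assms(2,3) unfolding A2_def by auto metis
qed

text \<open>Orthogonality to the monomials passes to polynomials by linearity and to their closure by continuity of
  the inner product; the bound with a parameter is used at an error below \<open>t\<close>.\<close>

lemma orthogonal_A2I:
  assumes g: "g \<in> L2 \<nu>" and mon: "\<And>\<alpha>. monomial \<alpha> \<in> L2 \<nu>"
    and orth: "\<And>\<alpha>. L2_inner \<nu> g (monomial \<alpha>) = 0" and h: "h \<in> A2 \<nu>"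
  shows "L2_inner \<nu> g h = 0"
proof -
  have hL: "h \<in> L2 \<nu>" using h by (rule A2_L2)
  have approx: "cmod (L2_inner \<nu> g h) \<le> t * ((L2_norm \<nu> g)\<^sup>2 + 1)" if t: "0 < t" for t
  proof -
    obtain p where p: "p \<in> polynomials" "p \<in> L2 \<nu>" "L2_norm \<nu> (\<lambda>z. h z - p z) < t"
      using h t unfolding A2_def mem_Collect_eq by blast
    obtain F a where pF: "p = (\<lambda>z. \<Sum>\<alpha>\<in>F. a \<alpha> * monomial \<alpha> z)"
      using p(1) unfolding polynomials_def by blast
    have "L2_inner \<nu> g p = 0"
      unfolding pF by (simp add: L2_inner_sum_right L2_cmult mon g L2_inner_cmult_right orth)
    then have "cmod (L2_inner \<nu> g h) = cmod (L2_inner \<nu> g (\<lambda>z. h z - p z))"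
      by (simp add: L2_inner_diff_right hL p g)
    also have "\<dots> \<le> t * (L2_norm \<nu> g)\<^sup>2 + (L2_norm \<nu> (\<lambda>z. h z - p z))\<^sup>2 / t"
      by (intro L2_inner_bound g L2_diff hL p t)
    also have "(L2_norm \<nu> (\<lambda>z. h z - p z))\<^sup>2 / t \<le> t\<^sup>2 / t"
      using p(3) t by (intro divide_right_mono power_mono) auto
    finally show ?thesis using t by (simp add: power2_eq_square algebra_simps)
  qed
  show ?thesis
  proof (rule ccontr)
    assume "L2_inner \<nu> g h \<noteq> 0"
    then have c: "0 < cmod (L2_inner \<nu> g h)" by simp
    define K where "K = (L2_norm \<nu> g)\<^sup>2 + 1"
    have K: "0 < K" unfolding K_def by (intro add_nonneg_pos) auto
    have "cmod (L2_inner \<nu> g h) \<le> cmod (L2_inner \<nu> g h) / (2 * K) * K"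
      unfolding K_def by (rule approx) (use c K in \<open>simp add: K_def[symmetric]\<close>)
    also have "\<dots> = cmod (L2_inner \<nu> g h) / 2" using K by simp
    finally have "cmod (L2_inner \<nu> g h) \<le> cmod (L2_inner \<nu> g h) / 2" .
    with \<open>L2_inner \<nu> g h \<noteq> 0\<close> show False by simp
  qed
qed

lemma canonical_solution_datum_L2:
  assumes "is_canonical_solution \<nu> \<alpha> i f"
  shows "(\<lambda>z. cnj (z $ i) * monomial \<alpha> z) \<in> L2 \<nu>"
  using assms L2_diff[of f \<nu> "\<lambda>z. f z - cnj (z $ i) * monomial \<alpha> z"]
  by (simp add: is_canonical_solution_def A2_L2)

text \<open>A canonical solution \<open>f\<close> is orthogonal to the difference between any canonical solution and the datum,
  so pairing \<open>f\<close> with \<open>g\<close>, with the datum and with \<open>f\<close> itself gives the same value.\<close>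

lemma canonical_solution_inner:
  assumes f: "is_canonical_solution \<nu> \<alpha> i f" and g: "is_canonical_solution \<nu> \<alpha> i g"
  shows "L2_inner \<nu> f g = of_real ((L2_norm \<nu> f)\<^sup>2)"
proof -
  let ?w = "\<lambda>z. cnj (z $ i) * monomial \<alpha> z"
  have w: "?w \<in> L2 \<nu>" using f by (rule canonical_solution_datum_L2)
  have *: "L2_inner \<nu> f h = L2_inner \<nu> f ?w" if "is_canonical_solution \<nu> \<alpha> i h" for h
  proof -
    have "L2_inner \<nu> f (\<lambda>z. h z - ?w z) = 0"
      using f that by (simp add: is_canonical_solution_def)
    then show ?thesis
      using f that w by (simp add: is_canonical_solution_def L2_inner_diff_right)
  qed
  show ?thesis using *[OF f] *[OF g] by (simp add: L2_inner_self)
qed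

text \<open>An arbitrary bounded extension is only known to take some canonical solution as its value on a monomial
  form. This transfers the explicit norm of \<open>solution \<alpha> i\<close> to that value.\<close>

lemma canonical_solution_norm_unique:
  assumes "is_canonical_solution \<nu> \<alpha> i f" "is_canonical_solution \<nu> \<alpha> i g"
  shows "(L2_norm \<nu> f)\<^sup>2 = (L2_norm \<nu> g)\<^sup>2"
proof -
  have "complex_of_real ((L2_norm \<nu> f)\<^sup>2) = cnj (of_real ((L2_norm \<nu> g)\<^sup>2))"
    unfolding canonical_solution_inner[OF assms, symmetric]
      canonical_solution_inner[OF assms(2,1), symmetric]
    by (rule L2_inner_commute)
  then show ?thesis by (simp only: complex_cnj_complex_of_real of_real_eq_iff)
qed

lemma is_canonical_solution_cong_AE:
  assumes "AE z in \<nu>. f z = g z" "is_canonical_solution \<nu> \<alpha> i f" "g \<in> L2 \<nu>"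
  shows "is_canonical_solution \<nu> \<alpha> i g"
  unfolding is_canonical_solution_def
proof (intro conjI ballI)
  note w = canonical_solution_datum_L2[OF assms(2)]
  have f: "f \<in> L2 \<nu>" "(\<lambda>z. f z - cnj (z $ i) * monomial \<alpha> z) \<in> A2 \<nu>"
    and orth: "\<And>h. h \<in> A2 \<nu> \<Longrightarrow> L2_inner \<nu> f h = 0"
    using assms(2) by (auto simp: is_canonical_solution_def)
  show "g \<in> L2 \<nu>" by fact
  show "(\<lambda>z. g z - cnj (z $ i) * monomial \<alpha> z) \<in> A2 \<nu>"
    by (rule A2_cong_AE[OF _ f(2) L2_diff[OF assms(3) w]]) (use assms(1) in auto)
  fix h assume h: "h \<in> A2 \<nu>"
  show "L2_inner \<nu> g h = 0"
    using L2_inner_cong_AE[OF assms(1)] L2_measurable[OF f(1)] L2_measurable[OF assms(3)]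
      L2_measurable[OF A2_L2[OF h]] orth[OF h] by simp
qed

lemma form_norm_power2: "(form_norm \<nu> \<omega>)\<^sup>2 = (\<Sum>i\<in>UNIV. (L2_norm \<nu> (\<omega> i))\<^sup>2)"
  by (simp add: form_norm_def sum_nonneg)

lemma form_norm_monomial_form: "(form_norm \<nu> (monomial_form \<alpha> i))\<^sup>2 = (L2_norm \<nu> (monomial \<alpha>))\<^sup>2"
proof -
  have "(L2_norm \<nu> (monomial_form \<alpha> i k))\<^sup>2 = (if k = i then (L2_norm \<nu> (monomial \<alpha>))\<^sup>2 else 0)" for k
    by (auto simp: monomial_form_def L2_norm_def)
  then show ?thesis by (simp add: form_norm_power2)
qed

section \<open>Boundedness in terms of the gaps\<close>

context rotation_product
begin

lemma solution_is_canonical: "is_canonical_solution \<nu> \<alpha> i (solution \<alpha> i)"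
  unfolding is_canonical_solution_def
proof (intro conjI ballI)
  show "solution \<alpha> i \<in> L2 \<nu>" by (rule solution_L2)
  have "(\<lambda>z. solution \<alpha> i z - cnj (z $ i) * monomial \<alpha> z)
      = (\<lambda>z. - of_real (factor.ratio i (\<alpha> i)) * monomial (\<alpha>(i := \<alpha> i - 1)) z)"
    by (simp add: solution_eq)
  then show "(\<lambda>z. solution \<alpha> i z - cnj (z $ i) * monomial \<alpha> z) \<in> A2 \<nu>"
    using cmult_monomial_A2[OF monomial_L2] by metis
  show "L2_inner \<nu> (solution \<alpha> i) h = 0" if "h \<in> A2 \<nu>" for h
    by (rule orthogonal_A2I[OF solution_L2 monomial_L2 inner_solution_monomial that])
qed

lemma monomial_form_A2: "monomial_form \<alpha> i \<in> A2_forms \<nu>"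
proof -
  have "(\<lambda>z. (if k = i then 1 else 0) * monomial \<alpha> z) \<in> A2 \<nu>" for k
    by (rule cmult_monomial_A2[OF monomial_L2])
  then show ?thesis
    by (simp add: A2_forms_def monomial_form_def if_distrib[of "\<lambda>c. c * _"] cong: if_cong)
qed

lemma gap_bounded_if_operator_bounded:
  assumes "canonical_solution_operator_bounded \<nu>"
  shows "\<exists>C. \<forall>i a. gap i a \<le> C"
proof -
  obtain T where T: "bounded_operator \<nu> T" "\<And>\<alpha> i. is_canonical_solution \<nu> \<alpha> i (T (monomial_form \<alpha> i))"
    using assms unfolding canonical_solution_operator_bounded_def by blast
  obtain B where B: "\<And>\<omega>. \<omega> \<in> A2_forms \<nu> \<Longrightarrow> L2_norm \<nu> (T \<omega>) \<le> B * form_norm \<nu> \<omega>"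
    using T(1) unfolding bounded_operator_def by blast
  have "gap i a \<le> B\<^sup>2" for i a
  proof -
    \<comment> \<open>Any multi-index with \<open>i\<close>-th entry \<open>a\<close> would do.\<close>
    define \<alpha> :: "'n \<Rightarrow> nat" where "\<alpha> = (\<lambda>_. a)"
    have "gap i a * (L2_norm \<nu> (monomial \<alpha>))\<^sup>2 = (L2_norm \<nu> (T (monomial_form \<alpha> i)))\<^sup>2"
      using canonical_solution_norm_unique[OF T(2) solution_is_canonical, of \<alpha> i] solution_norm[of \<alpha> i]
      by (simp add: \<alpha>_def)
    also have "\<dots> \<le> (B * form_norm \<nu> (monomial_form \<alpha> i))\<^sup>2"
      by (intro power_mono B monomial_form_A2) simp
    also have "\<dots> = B\<^sup>2 * (L2_norm \<nu> (monomial \<alpha>))\<^sup>2"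
      by (simp add: power_mult_distrib form_norm_monomial_form)
    finally show ?thesis using monomial_norm_pos by simp
  qed
  then show ?thesis by blast
qed

text \<open>Finite sets of basis forms that increase to the whole orthogonal basis.\<close>

definition index_box :: "nat \<Rightarrow> (('n \<Rightarrow> nat) \<times> 'n) set" where
  "index_box N = {\<alpha>. \<forall>k. \<alpha> k \<le> N} \<times> UNIV"

text \<open>The operator applied to the part of the Fourier expansion of \<open>\<omega>\<close> that is supported on
  \<open>index_box N\<close>.\<close>

definition partial_sum :: "'n form \<Rightarrow> nat \<Rightarrow> complex ^ 'n \<Rightarrow> complex" where
  "partial_sum \<omega> N z = (\<Sum>b\<in>index_box N. fourier \<nu> (monomial (fst b)) (\<omega> (snd b)) * solution (fst b) (snd b) z)"

lemma finite_bounded_indices: "finite {\<alpha>::'n \<Rightarrow> nat. \<forall>k. \<alpha> k \<le> N}"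
proof -
  have "{\<alpha>::'n \<Rightarrow> nat. \<forall>k. \<alpha> k \<le> N} = PiE UNIV (\<lambda>_. {..N})" by (auto simp: PiE_def)
  then show ?thesis by (simp add: finite_PiE)
qed

lemma finite_index_box: "finite (index_box N)"
  unfolding index_box_def by (intro finite_cartesian_product finite_bounded_indices) auto

lemma incseq_index_box: "incseq index_box"
  by (auto simp: incseq_def index_box_def intro: order_trans)

lemma coefficient_sum_le:
  assumes "\<omega> \<in> A2_forms \<nu>"
  shows "(\<Sum>b\<in>index_box N. (cmod (fourier \<nu> (monomial (fst b)) (\<omega> (snd b))))\<^sup>2 * (L2_norm \<nu> (monomial (fst b)))\<^sup>2)
     \<le> (form_norm \<nu> \<omega>)\<^sup>2"
proof -
  let ?c = "\<lambda>\<alpha> i. (cmod (fourier \<nu> (monomial \<alpha>) (\<omega> i)))\<^sup>2 * (L2_norm \<nu> (monomial \<alpha>))\<^sup>2"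
  have "(\<Sum>b\<in>index_box N. ?c (fst b) (snd b)) = (\<Sum>\<alpha>\<in>{\<alpha>. \<forall>k. \<alpha> k \<le> N}. \<Sum>i\<in>UNIV. ?c \<alpha> i)"
    unfolding index_box_def sum.cartesian_product by (simp add: case_prod_beta)
  also have "\<dots> = (\<Sum>i\<in>UNIV. \<Sum>\<alpha>\<in>{\<alpha>. \<forall>k. \<alpha> k \<le> N}. ?c \<alpha> i)"
    by (rule sum.swap)
  also have "\<dots> \<le> (\<Sum>i\<in>UNIV. (L2_norm \<nu> (\<omega> i))\<^sup>2)"
    using assms
    by (intro sum_mono bessel_inequality monomial_L2 finite_bounded_indices A2_L2)
       (auto simp: inner_monomials A2_forms_def)
  finally show ?thesis by (simp add: form_norm_power2)
qed

lemma partial_sum_L2: "partial_sum \<omega> N \<in> L2 \<nu>"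
  unfolding partial_sum_def[abs_def] by (intro L2_sum L2_cmult solution_L2)

lemma solution_orthogonal:
  "b \<noteq> b' \<Longrightarrow> L2_inner \<nu> (solution (fst b) (snd b)) (solution (fst b') (snd b')) = 0"
  by (rule inner_solutions) (simp add: prod_eq_iff)

text \<open>The images of the basis forms are pairwise orthogonal and at most \<open>sqrt C\<close> times as long as the
  basis forms, so the operator is bounded on each Fourier sum with a constant that does not depend on \<open>N\<close>.\<close>

lemma partial_sum_weights_le:
  assumes C: "\<And>i a. gap i a \<le> C" "0 \<le> C" and \<omega>: "\<omega> \<in> A2_forms \<nu>"
  shows "(\<Sum>b\<in>index_box N. (cmod (fourier \<nu> (monomial (fst b)) (\<omega> (snd b))))\<^sup>2 * (L2_norm \<nu> (solution (fst b) (snd b)))\<^sup>2)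
     \<le> C * (form_norm \<nu> \<omega>)\<^sup>2"
proof -
  have "(\<Sum>b\<in>index_box N. (cmod (fourier \<nu> (monomial (fst b)) (\<omega> (snd b))))\<^sup>2 * (L2_norm \<nu> (solution (fst b) (snd b)))\<^sup>2)
     \<le> (\<Sum>b\<in>index_box N. C * ((cmod (fourier \<nu> (monomial (fst b)) (\<omega> (snd b))))\<^sup>2 * (L2_norm \<nu> (monomial (fst b)))\<^sup>2))"
  proof (rule sum_mono)
    fix b
    have "gap (snd b) (fst b (snd b)) * ((cmod (fourier \<nu> (monomial (fst b)) (\<omega> (snd b))))\<^sup>2 * (L2_norm \<nu> (monomial (fst b)))\<^sup>2)
      \<le> C * ((cmod (fourier \<nu> (monomial (fst b)) (\<omega> (snd b))))\<^sup>2 * (L2_norm \<nu> (monomial (fst b)))\<^sup>2)"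
      by (intro mult_right_mono C) simp
    then show "(cmod (fourier \<nu> (monomial (fst b)) (\<omega> (snd b))))\<^sup>2 * (L2_norm \<nu> (solution (fst b) (snd b)))\<^sup>2
      \<le> C * ((cmod (fourier \<nu> (monomial (fst b)) (\<omega> (snd b))))\<^sup>2 * (L2_norm \<nu> (monomial (fst b)))\<^sup>2)"
      by (simp add: solution_norm mult_ac)
  qed
  also have "\<dots> \<le> C * (form_norm \<nu> \<omega>)\<^sup>2"
    unfolding sum_distrib_left[symmetric] by (intro mult_left_mono coefficient_sum_le \<omega> C)
  finally show ?thesis .
qed

lemma partial_sum_norm_le:
  assumes "\<And>i a. gap i a \<le> C" "0 \<le> C" "\<omega> \<in> A2_forms \<nu>"
  shows "(L2_norm \<nu> (partial_sum \<omega> N))\<^sup>2 \<le> C * (form_norm \<nu> \<omega>)\<^sup>2"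
  unfolding partial_sum_def[abs_def]
  using partial_sum_weights_le[OF assms]
  by (subst L2_norm_orthogonal_sum) (auto simp: solution_L2 finite_index_box intro: solution_orthogonal)

lemma partial_sum_linear:
  assumes "\<omega> \<in> A2_forms \<nu>" "\<eta> \<in> A2_forms \<nu>"
  shows "partial_sum (\<lambda>i w. a * \<omega> i w + b * \<eta> i w) N z = a * partial_sum \<omega> N z + b * partial_sum \<eta> N z"
proof -
  have "fourier \<nu> (monomial \<alpha>) (\<lambda>w. a * \<omega> i w + b * \<eta> i w)
      = a * fourier \<nu> (monomial \<alpha>) (\<omega> i) + b * fourier \<nu> (monomial \<alpha>) (\<eta> i)" for \<alpha> i
    using assms by (intro fourier_linear monomial_L2) (auto simp: A2_forms_def A2_L2)
  then show ?thesis
    by (simp add: partial_sum_def sum_distrib_left distrib_left sum.distrib mult_ac)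
qed

lemma partial_sum_monomial_form:
  assumes "\<And>k. \<alpha> k \<le> N"
  shows "partial_sum (monomial_form \<alpha> i) N = solution \<alpha> i"
proof
  fix z
  have c: "fourier \<nu> (monomial (fst b)) (monomial_form \<alpha> i (snd b)) = (if b = (\<alpha>, i) then 1 else 0)" for b
  proof (cases "snd b = i")
    case True
    then show ?thesis
      using monomial_norm_pos[of \<alpha>] inner_monomials[of \<alpha> "fst b"] L2_inner_self[of \<nu> "monomial \<alpha>"]
      by (auto simp: monomial_form_def fourier_def prod_eq_iff simp del: of_real_prod)
  next
    case False
    then show ?thesis by (auto simp: monomial_form_def fourier_def L2_inner_def)
  qed
  have "partial_sum (monomial_form \<alpha> i) N z = (\<Sum>b\<in>index_box N. if b = (\<alpha>, i) then solution \<alpha> i z else 0)"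
    unfolding partial_sum_def c by (intro sum.cong) auto
  also have "\<dots> = solution \<alpha> i z" using assms finite_index_box by (simp add: index_box_def)
  finally show "partial_sum (monomial_form \<alpha> i) N z = solution \<alpha> i z" .
qed

text \<open>The operator is the limit in norm of the partial sums. A limit is determined almost everywhere, which is
  what makes a choice of representatives linear almost everywhere; on a monomial form the partial sums are eventually
  equal to the explicit solution.\<close>

lemma operator_bounded_if_gap_bounded:
  assumes C: "\<And>i a. gap i a \<le> C"
  shows "canonical_solution_operator_bounded \<nu>"
proof -
  have C': "gap i a \<le> max C 0" for i a using C[of i a] by simp
  define lim_of where "lim_of \<omega> f \<longleftrightarrow> f \<in> L2 \<nu> \<and>
      (\<lambda>N. (L2_norm \<nu> (\<lambda>z. f z - partial_sum \<omega> N z))\<^sup>2) \<longlonglongrightarrow> 0" for \<omega> f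
  define T where "T \<omega> = (SOME f. lim_of \<omega> f)" for \<omega>
  have chosen: "lim_of \<omega> (T \<omega>)" if "lim_of \<omega> f" for \<omega> f
    unfolding T_def using that by (rule someI[where P = "lim_of \<omega>"])
  have T: "lim_of \<omega> (T \<omega>)" if "\<omega> \<in> A2_forms \<nu>" for \<omega>
  proof -
    have "\<exists>f\<in>L2 \<nu>. (\<lambda>N. (L2_norm \<nu> (\<lambda>z. f z - partial_sum \<omega> N z))\<^sup>2) \<longlonglongrightarrow> 0"
      unfolding partial_sum_def
      by (rule orthogonal_series_converges[OF solution_L2 solution_orthogonal finite_index_box incseq_index_box
            partial_sum_weights_le[OF C' _ that]]) auto
    then show ?thesis using chosen unfolding lim_of_def by blast
  qed
  have unique: "AE z in \<nu>. f z = g z" if "lim_of \<omega> f" "lim_of \<omega> g" for \<omega> f g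
    using that unfolding lim_of_def by (intro L2_limit_unique_AE[OF partial_sum_L2[of \<omega>]]) auto
  have linear: "AE z in \<nu>. T (\<lambda>i w. a * \<omega> i w + b * \<eta> i w) z = a * T \<omega> z + b * T \<eta> z"
    if \<omega>: "\<omega> \<in> A2_forms \<nu>" and \<eta>: "\<eta> \<in> A2_forms \<nu>" for \<omega> \<eta> a b
  proof -
    let ?L = "\<lambda>i w. a * \<omega> i w + b * \<eta> i w"
    have fg: "(\<lambda>z. a * T \<omega> z + b * T \<eta> z) \<in> L2 \<nu>"
      using T[OF \<omega>] T[OF \<eta>] by (auto simp: lim_of_def intro: L2_add L2_cmult)
    have "lim_of ?L (\<lambda>z. a * T \<omega> z + b * T \<eta> z)"
      unfolding lim_of_def partial_sum_linear[OF \<omega> \<eta>]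
      using T[OF \<omega>] T[OF \<eta>]
      by (intro conjI fg L2_limit_linear partial_sum_L2) (auto simp: lim_of_def)
    moreover from this have "lim_of ?L (T ?L)" by (rule chosen)
    ultimately show ?thesis using unique by blast
  qed
  have bound: "L2_norm \<nu> (T \<omega>) \<le> sqrt (2 * max C 0) * form_norm \<nu> \<omega>" if "\<omega> \<in> A2_forms \<nu>" for \<omega>
  proof -
    have "(L2_norm \<nu> (T \<omega>))\<^sup>2 \<le> 2 * (max C 0 * (form_norm \<nu> \<omega>)\<^sup>2)"
      using T[OF that] partial_sum_norm_le[OF C' _ that] unfolding lim_of_def
      by (intro L2_norm_limit_le[OF partial_sum_L2[of \<omega>]]) auto
    also have "\<dots> = (sqrt (2 * max C 0) * form_norm \<nu> \<omega>)\<^sup>2"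
      by (simp add: power_mult_distrib)
    finally show ?thesis
      by (rule power2_le_imp_le) (auto simp: form_norm_def sum_nonneg)
  qed
  have "is_canonical_solution \<nu> \<alpha> i (T (monomial_form \<alpha> i))" for \<alpha> i
  proof (rule is_canonical_solution_cong_AE[OF unique solution_is_canonical])
    show "lim_of (monomial_form \<alpha> i) (T (monomial_form \<alpha> i))"
      by (rule T[OF monomial_form_A2])
    then show "T (monomial_form \<alpha> i) \<in> L2 \<nu>" by (simp add: lim_of_def)
    have "\<forall>\<^sub>F N in sequentially. (L2_norm \<nu> (\<lambda>z. solution \<alpha> i z - partial_sum (monomial_form \<alpha> i) N z))\<^sup>2 = 0"
      using eventually_ge_at_top[of "Max (range \<alpha>)"]
    proof eventually_elim
      case (elim N)
      have "\<alpha> k \<le> N" for k using elim Max_ge[of "range \<alpha>" "\<alpha> k"] by simp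
      then show ?case by (simp add: partial_sum_monomial_form L2_norm_def)
    qed
    then show "lim_of (monomial_form \<alpha> i) (solution \<alpha> i)"
      unfolding lim_of_def by (auto intro: solution_L2 tendsto_eventually)
  qed
  moreover have "bounded_operator \<nu> T"
    unfolding bounded_operator_def
  proof (intro conjI)
    show "\<forall>\<omega>\<in>A2_forms \<nu>. T \<omega> \<in> L2 \<nu>" using T by (simp add: lim_of_def)
  qed (use linear bound in blast)+
  ultimately show ?thesis unfolding canonical_solution_operator_bounded_def by blast
qed

text \<open>The criterion in terms of \<open>moment_recip\<close> controls all gaps except those at exponent \<open>0\<close>, of which
  there are finitely many.\<close>

lemma gap_bounded_iff:
  "(\<exists>C. \<forall>i a. gap i a \<le> C) \<longleftrightarrow>
   (\<exists>C. \<forall>j k. moment_recip (\<mu> k) (j + 1) / moment_recip (\<mu> k) (j + 2)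
               - moment_recip (\<mu> k) j / moment_recip (\<mu> k) (j + 1) < C)"
  unfolding factor.ratio_diff_eq_moment_recip[symmetric] gap_def[symmetric]
proof
  assume "\<exists>C. \<forall>i a. gap i a \<le> C"
  then obtain C where "\<And>i a. gap i a \<le> C" by blast
  then have "\<forall>j k. gap k (Suc j) < C + 1" by (auto intro: le_less_trans[of _ C])
  then show "\<exists>C. \<forall>j k. gap k (Suc j) < C" by blast
next
  assume "\<exists>C. \<forall>j k. gap k (Suc j) < C"
  then obtain C where C: "\<And>j k. gap k (Suc j) < C" by blast
  have "gap i a \<le> max C (Max (range (\<lambda>i. gap i 0)))" for i a
    using C[of i "a - 1"] Max_ge[of "range (\<lambda>i. gap i 0)" "gap i 0"] by (cases a) (auto simp: le_max_iff_disj)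
  then show "\<exists>C. \<forall>i a. gap i a \<le> C" by blast
qed

theorem operator_bounded_iff:
  "canonical_solution_operator_bounded \<nu> \<longleftrightarrow>
   (\<exists>C. \<forall>j k. moment_recip (\<mu> k) (j + 1) / moment_recip (\<mu> k) (j + 2)
               - moment_recip (\<mu> k) j / moment_recip (\<mu> k) (j + 1) < C)"
  unfolding gap_bounded_iff[symmetric]
  using gap_bounded_if_operator_bounded operator_bounded_if_gap_bounded by blast

end

theorem corollary5:
  fixes \<mu> :: "'n::finite \<Rightarrow> complex measure"
  assumes "\<And>k. sets (\<mu> k) = sets borel"
    and "\<And>k. circle_invariant (\<mu> k)"
    and "\<And>k j. integrable (\<mu> k) (\<lambda>z. cmod z ^ (2 * j))"
    and "\<And>k j. 0 < (\<integral>z. cmod z ^ (2 * j) \<partial>\<mu> k)"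
  shows "(canonical_solution_operator_bounded (prod_measure \<mu>) \<longleftrightarrow>
            (\<exists>C. \<forall>j k. moment_recip (\<mu> k) (j + 1) / moment_recip (\<mu> k) (j + 2)
                      - moment_recip (\<mu> k) j / moment_recip (\<mu> k) (j + 1) < C)) \<and>
         (canonical_solution_operator_bounded (prod_measure \<mu>) \<longleftrightarrow>
            (\<forall>k. canonical_solution_operator_bounded (line_measure (\<mu> k))))"
proof -
  have rm: "rotation_measure (\<mu> k)" for k
    using assms by (simp add: rotation_measure_def)
  interpret rotation_product \<mu> by (simp add: rotation_product_def rm)
  let ?d = "\<lambda>k j. moment_recip (\<mu> k) (j + 1) / moment_recip (\<mu> k) (j + 2)
                      - moment_recip (\<mu> k) j / moment_recip (\<mu> k) (j + 1)"
  have line: "canonical_solution_operator_bounded (line_measure (\<mu> k)) \<longleftrightarrow> (\<exists>C. \<forall>j. ?d k j < C)" for k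
  proof -
    interpret line: rotation_product "\<lambda>_::1. \<mu> k" by (simp add: rotation_product_def rm)
    show ?thesis
      unfolding line_measure_eq_prod_measure[OF rm] line.operator_bounded_iff by simp
  qed
  have "(\<exists>C. \<forall>j k. ?d k j < C) \<longleftrightarrow> (\<forall>k. \<exists>C. \<forall>j. ?d k j < C)"
  proof
    assume "\<forall>k. \<exists>C. \<forall>j. ?d k j < C"
    then obtain C where C: "\<And>k j. ?d k j < C k" by metis
    have "?d k j < Max (range C)" for j k
      using C[of k j] Max_ge[of "range C" "C k"] by (rule less_le_trans) auto
    then show "\<exists>C. \<forall>j k. ?d k j < C" by blast
  qed blast
  then show ?thesis using operator_bounded_iff line by blast
qed

end
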